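(* Let $n\ge 2$ be an integer, let $\rho$ be a density function on $\mathbb{R}^n$ (if $n=2$, assume in addition that $\rho$ is nonzero on a set of positive measure), and let $$V_\rho(x)=\frac{n}{\omega_n}\int_{\mathbb{R}^n}\frac{\rho(\zeta)\,d\zeta}{|x-\zeta|^n}.$$ Then the function $$x\mapsto\begin{cases}\log \mathcal{M}_2(V_\rho(x)), & n=2,\\[4pt] \left[\mathcal{M}_n(V_\rho(x))\right]^{(n-2)/n}, & n\ge 3,\end{cases}$$ is subharmonic in $\mathbb{R}^n\setminus\operatorname{supp}\rho$. Moreover, if $B\subset\mathbb{R}^n$ is an arbitrary closed Euclidean ball of positive radius and $\rho=\chi_B$ is its characteristic function, then this function is harmonic in $\mathbb{R}^n\setminus B$.
   Context: A density function on $\mathbb{R}^n$ is a measurable function $\rho$ with compact support and $0\le\rho\le 1$; $\operatorname{supp}\rho$ is its closed (essential) support. $\omega_n$ denotes the $(n-1)$-dimensional Lebesgue measure of the unit sphere in $\mathbb{R}^n$. For an integer $n\ge1$, the profile function $\mathcal{M}_n:[0,\infty)\to[0,1)$ is the solution of the ODE $\mathcal{M}_n'(t)=1-\mathcal{M}_n(t)^{2/n}$, $\mathcal{M}_n(0)=0$. *)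

theory Defs
  imports "HOL-Analysis.Analysis"
begin

section \<open>Density functions\<close>

definition essential_support :: "(real^'n \<Rightarrow> real) \<Rightarrow> (real^'n) set" where
  "essential_support \<rho> =
     {x. \<forall>U. open U \<longrightarrow> x \<in> U \<longrightarrow> \<not> (AE y in lebesgue. y \<in> U \<longrightarrow> \<rho> y = 0)}"

definition density_function :: "(real^'n \<Rightarrow> real) \<Rightarrow> bool" where
  "density_function \<rho> \<longleftrightarrow>
     \<rho> \<in> borel_measurable lebesgue \<and> compact (essential_support \<rho>) \<and> (\<forall>x. 0 \<le> \<rho> x \<and> \<rho> x \<le> 1)"

section \<open>The profile function and the potential\<close>

text \<open>
  The profile function lives on \<open>[0, \<infinity>)\<close>; the extensional function space makes the solution of
  the initial value problem unique as a total function. At \<open>t = 0\<close> the derivative is one-sided,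
  and \<open>0 powr (2 / n) = 0\<close> agrees with the mathematical value because the exponent is positive.
\<close>

definition profile :: "nat \<Rightarrow> real \<Rightarrow> real" where
  "profile n = (THE M. M \<in> {0..} \<rightarrow>\<^sub>E {0..<1} \<and> M 0 = 0 \<and>
     (\<forall>t\<ge>0. (M has_real_derivative (1 - M t powr (2 / real n))) (at t within {0..})))"

text \<open>
  Lebesgue measure on the unit sphere of \<open>\<real>\<^sup>n\<close>, obtained from polar coordinates: the measure of
  \<open>A\<close> is \<open>n\<close> times the volume of the cone over \<open>A\<close> with apex \<open>0\<close>.
\<close>

definition unit_sphere_measure :: "(real^'n) set \<Rightarrow> real" where
  "unit_sphere_measure A =
     real CARD('n) * measure lebesgue {t *\<^sub>R a | t a. 0 < t \<and> t \<le> 1 \<and> a \<in> A}"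

definition potential :: "(real^'n \<Rightarrow> real) \<Rightarrow> real^'n \<Rightarrow> real" where
  "potential \<rho> x =
     real CARD('n) / unit_sphere_measure (sphere (0::real^'n) 1) *
     (LINT z|lebesgue. \<rho> z / norm (x - z) ^ CARD('n))"

definition profile_transform :: "(real^'n \<Rightarrow> real) \<Rightarrow> real^'n \<Rightarrow> real" where
  "profile_transform \<rho> x =
     (if CARD('n) = 2 then ln (profile 2 (potential \<rho> x))
      else profile CARD('n) (potential \<rho> x) powr ((real CARD('n) - 2) / real CARD('n)))"

section \<open>Harmonic and subharmonic functions\<close>

text \<open>\<open>g\<close> is the gradient and \<open>H\<close> the Hessian matrix of \<open>f\<close>.\<close>

definition C2_on :: "(real^'n) set \<Rightarrow> (real^'n \<Rightarrow> real) \<Rightarrow> bool" where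
  "C2_on S f \<longleftrightarrow>
     (\<exists>(g :: real^'n \<Rightarrow> real^'n) (H :: real^'n \<Rightarrow> real^'n^'n).
        (\<forall>x\<in>S. (f has_derivative (\<lambda>v. g x \<bullet> v)) (at x)) \<and>
        (\<forall>x\<in>S. (g has_derivative (\<lambda>v. H x *v v)) (at x)) \<and>
        continuous_on S H)"

definition partial_deriv :: "'n \<Rightarrow> (real^'n \<Rightarrow> real) \<Rightarrow> real^'n \<Rightarrow> real" where
  "partial_deriv i f x = deriv (\<lambda>t. f (x + t *\<^sub>R axis i 1)) 0"

definition laplacian :: "(real^'n \<Rightarrow> real) \<Rightarrow> real^'n \<Rightarrow> real" where
  "laplacian f x = (\<Sum>i\<in>UNIV. partial_deriv i (partial_deriv i f) x)"

definition harmonic_on :: "(real^'n) set \<Rightarrow> (real^'n \<Rightarrow> real) \<Rightarrow> bool" where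
  "harmonic_on S f \<longleftrightarrow> open S \<and> C2_on S f \<and> (\<forall>x\<in>S. laplacian f x = 0)"

definition upper_semicontinuous_on :: "(real^'n) set \<Rightarrow> (real^'n \<Rightarrow> real) \<Rightarrow> bool" where
  "upper_semicontinuous_on S u \<longleftrightarrow>
     (\<forall>x\<in>S. \<forall>a. u x < a \<longrightarrow> (\<forall>\<^sub>F y in at x within S. u y < a))"

text \<open>
  Subharmonicity by comparison with harmonic functions on balls, for real-valued (hence nowhere
  \<open>-\<infinity>\<close>) functions.
\<close>

definition subharmonic_on :: "(real^'n) set \<Rightarrow> (real^'n \<Rightarrow> real) \<Rightarrow> bool" where
  "subharmonic_on S u \<longleftrightarrow>
     open S \<and> upper_semicontinuous_on S u \<and>
     (\<forall>c r h. 0 < r \<longrightarrow> cball c r \<subseteq> S \<longrightarrow>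
        continuous_on (cball c r) h \<longrightarrow> harmonic_on (ball c r) h \<longrightarrow>
        (\<forall>x\<in>sphere c r. u x \<le> h x) \<longrightarrow> (\<forall>x\<in>ball c r. u x \<le> h x))"

end

(*
  Write w for the volume of the unit ball and F(V) for the transform of the potential V. The chain
  rule and the equation of the profile M show that the Laplacian of F(V) is a nonnegative multiple
  of w M(V) B - |A|^2, where, with the point x moved to the origin,
  A = int rho(z) z |z|^(-n-2) dz and B = int rho(z) |z|^(-n-2) dz.

  This quantity vanishes when rho is the indicator of a ball with centre c and radius s, for which
  M(V) = (s/|c|)^n. The general estimate follows by comparing rho with the ball D having the same V
  and a suitable centre on the ray of A: (rho - 1_D)(|z - c|^2 - s^2) >= 0 pointwise, and after
  division by |z|^(n+2) and integration this is the claim.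

  The integrals over a ball come from the mean value property of the Poisson kernel
  (|c|^2 - |z|^2) / |c + z|^n, which is harmonic for |z| < |c|, and from the identity
  int_{|y|<1} ((1 - |y|^2) div X - 2 y.X) dy = 0 for smooth vector fields X. Nonnegativity of the
  Laplacian gives subharmonicity by the maximum principle.
*)
theory Submission
  imports Defs
begin

section \<open>The profile function\<close>

text \<open>The expansion |z - c|^2 - s^2 = |z|^2 - 2 z.c + (|c|^2 - s^2) explains the divisor
  |z|^(n+2): the three terms integrate to multiples of V, A.c and B, the only data of rho that occur
  in the Laplacian. Requiring D to have the same V as rho fixes only the ratio s/|c|. The scale |c|
  remains free; the inequality is quadratic in it, and at the optimal scale it reads |A|^2 <= w M(V)
  B. The equation of the profile enters through the potential of a ball: as a function of m =
  (s/|c|)^n this potential is the primitive G(m) of 1/(1 - m^(2/n)) with G(0) = 0, which is the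
  inverse of M. The weight 1 - |y|^2 vanishes on the unit sphere, so integration by parts leaves no
  surface integrals. Every ball integral is moved to the unit ball, where the radius s is a
  parameter of the integrand, and is then evaluated by differentiating in s or by combining such
  divergence identities.\<close>

lemma inverse_profile_exists:
  fixes a :: real
  assumes "0 < a" "a \<le> 1"
  obtains G :: "real \<Rightarrow> real" where "G 0 = 0"
    and "\<And>m. \<bar>m\<bar> < 1 \<Longrightarrow> (G has_real_derivative 1 / (1 - \<bar>m\<bar> powr a)) (at m)"
proof -
  have lt1: "\<bar>x\<bar> powr a < 1" if "\<bar>x\<bar> < 1" for x :: real
    using assms that powr_less_one[of "\<bar>x\<bar>" a] powr_less_mono2[of a "\<bar>x\<bar>" 1] by auto
  have cont: "isCont (\<lambda>x::real. 1 / (1 - \<bar>x\<bar> powr a)) x" if "\<bar>x\<bar> < 1" for x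
  proof -
    have "continuous_on UNIV (\<lambda>x::real. \<bar>x\<bar> powr a)"
      by (rule continuous_on_powr') (use assms in \<open>auto intro!: continuous_intros\<close>)
    then have "isCont (\<lambda>x::real. \<bar>x\<bar> powr a) x"
      by (simp add: continuous_on_eq_continuous_at)
    then show ?thesis
      using lt1[OF that] by (intro isCont_divide isCont_diff continuous_const) auto
  qed
  \<comment> \<open>The absolute value makes the integrand continuous on the open interval (-1, 1),
    so the primitive has a two-sided derivative at 0 as well.\<close>
  have "\<exists>F. \<forall>x::real. ereal (-1) < x \<longrightarrow> x < ereal 1 \<longrightarrow>
      (F has_vector_derivative (1 / (1 - \<bar>x\<bar> powr a))) (at x)"
    by (rule einterval_antiderivative) (auto intro!: cont simp: abs_less_iff)
  then obtain F :: "real \<Rightarrow> real" where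
    F: "\<And>x. \<bar>x\<bar> < 1 \<Longrightarrow> (F has_real_derivative 1 / (1 - \<bar>x\<bar> powr a)) (at x)"
    by (auto simp: abs_less_iff has_real_derivative_iff_has_vector_derivative)
  show thesis
  proof (rule that[of "\<lambda>x. F x - F 0"])
    show "((\<lambda>x. F x - F 0) has_real_derivative 1 / (1 - \<bar>m\<bar> powr a)) (at m)" if "\<bar>m\<bar> < 1" for m
      using DERIV_diff[OF F[OF that] DERIV_const[of "F 0"]] by simp
  qed simp
qed

text \<open>Separation of variables: M' = 1 - M^(2/n) with M(0) = 0 says that G(M(t)) = t for the
  primitive G of 1/(1 - m^(2/n)). Inverting G gives existence, and injectivity of G gives
  uniqueness, so the definite description in \<open>profile\<close> denotes this inverse.\<close>

lemma profile_inverse: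
  fixes n :: nat
  assumes n: "n \<ge> 2"
  obtains G where "G 0 = 0"
    and "\<And>m. 0 \<le> m \<Longrightarrow> m < 1 \<Longrightarrow> (G has_real_derivative 1 / (1 - m powr (2 / n))) (at m)"
    and "\<And>m. 0 \<le> m \<Longrightarrow> m < 1 \<Longrightarrow> profile n (G m) = m"
    and "\<And>t. 0 \<le> t \<Longrightarrow> 0 \<le> profile n t \<and> profile n t < 1 \<and> G (profile n t) = t"
    and "\<And>t. 0 < t \<Longrightarrow> 0 < profile n t"
    and "\<And>t. 0 < t \<Longrightarrow> (profile n has_real_derivative (1 - profile n t powr (2 / n))) (at t)"
    and "profile n 0 = 0"
proof -
  define a where "a = 2 / real n"
  have a: "0 < a" "a \<le> 1" using n by (auto simp: a_def)
  obtain G :: "real \<Rightarrow> real" where G0: "G 0 = 0"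
    and Gd: "\<And>m. \<bar>m\<bar> < 1 \<Longrightarrow> (G has_real_derivative 1 / (1 - \<bar>m\<bar> powr a)) (at m)"
    using inverse_profile_exists[OF a] by blast
  have lt1: "\<bar>x\<bar> powr a < 1" if "\<bar>x\<bar> < 1" for x :: real
    using a that powr_less_mono2[of a "\<bar>x\<bar>" 1] by auto
  have Gmono: "G x < G y" if "-1 < x" "x < y" "y < 1" for x y
  proof (rule DERIV_pos_imp_increasing[OF that(2)])
    fix z assume "x \<le> z" "z \<le> y"
    then have "\<bar>z\<bar> < 1" using that by auto
    from Gd[OF this] lt1[OF this] show "\<exists>d. (G has_real_derivative d) (at z) \<and> 0 < d" by auto
  qed
  have Gcont: "isCont G x" if "\<bar>x\<bar> < 1" for x
    using Gd[OF that] DERIV_isCont by blast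
  \<comment> \<open>As a \<le> 1, x \<le> x^a on [0, 1), so the derivative of G dominates 1/(1 - x).
    Hence G is unbounded near 1, and its inverse is defined for all times and stays below 1.\<close>
  have Glower: "- ln (1 - m) \<le> G m" if "0 \<le> m" "m < 1" for m
  proof -
    have "(\<lambda>x. G x + ln (1 - x)) 0 \<le> (\<lambda>x. G x + ln (1 - x)) m"
    proof (rule DERIV_nonneg_imp_nondecreasing[where f = "\<lambda>x. G x + ln (1 - x)" and a = 0 and b = m])
      show "0 \<le> m" by fact
      fix x assume x: "0 \<le> x" "x \<le> m"
      have x1: "x < 1" using x that by simp
      have "x powr 1 \<le> x powr a"
        using x x1 a by (intro powr_mono') auto
      then have "1 / (1 - x) \<le> 1 / (1 - x powr a)"
        using x x1 lt1[of x] by (intro divide_left_mono) auto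
      moreover have "((\<lambda>x. G x + ln (1 - x)) has_real_derivative
          1 / (1 - x powr a) + (-1) / (1 - x)) (at x)"
        using x x1 Gd[of x] by (auto intro!: derivative_eq_intros)
      ultimately show "\<exists>y. ((\<lambda>x. G x + ln (1 - x)) has_real_derivative y) (at x) \<and> 0 \<le> y"
        by (intro exI conjI) auto
    qed
    then show ?thesis by (simp add: G0)
  qed
  have Gnonneg: "0 \<le> G m" if "0 \<le> m" "m < 1" for m
  proof -
    have "ln (1 - m) \<le> 0" using that by simp
    then show ?thesis using Glower[OF that] by linarith
  qed
  have surj: "\<exists>m. 0 \<le> m \<and> m < 1 \<and> G m = t" if "0 \<le> t" for t
  proof -
    \<comment> \<open>Chosen so that -ln (1 - b) = t; the lower bound then gives t \<le> G b and the
      intermediate value theorem applies on [0, b].\<close>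
    define b where "b = 1 - exp (-t)"
    have b: "0 \<le> b" "b < 1" using that by (auto simp: b_def)
    have "t \<le> G b" using Glower[OF b] by (simp add: b_def)
    then have "\<exists>x. 0 \<le> x \<and> x \<le> b \<and> G x = t"
      using that b Gcont G0 by (intro IVT) auto
    then show ?thesis using b by force
  qed
  define M0 where "M0 = (\<lambda>t. SOME m. 0 \<le> m \<and> m < 1 \<and> G m = t)"
  have M0: "0 \<le> M0 t \<and> M0 t < 1 \<and> G (M0 t) = t" if "0 \<le> t" for t
    unfolding M0_def using surj[OF that] by (rule someI_ex)
  have Ginj: "x = y" if "G x = G y" "\<bar>x\<bar> < 1" "\<bar>y\<bar> < 1" for x y
    using Gmono[of x y] Gmono[of y x] that by (cases x y rule: linorder_cases) (auto simp: abs_less_iff)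
  have M0G: "M0 (G m) = m" if "0 \<le> m" "m < 1" for m
  proof -
    have "0 \<le> G m" using Gnonneg[OF that] .
    from M0[OF this] have "G (M0 (G m)) = G m" "\<bar>M0 (G m)\<bar> < 1" by auto
    then show ?thesis by (rule Ginj) (use that in auto)
  qed
  let ?P = "\<lambda>M::real\<Rightarrow>real. M \<in> {0..} \<rightarrow>\<^sub>E {0..<1} \<and> M 0 = 0 \<and>
     (\<forall>t\<ge>0. (M has_real_derivative (1 - M t powr (2 / real n))) (at t within {0..}))"
  define M1 where "M1 = restrict M0 {0..}"
  \<comment> \<open>For an arbitrary solution the chain rule and the differential equation give G(M
    t) - t the derivative 0, and its value at 0 is 0.\<close>
  have GM: "G (M t) = t" if P: "?P M" and t: "0 \<le> t" for M t
  proof -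
    have d: "((\<lambda>t. G (M t) - t) has_real_derivative 0) (at x within {0..t})" if x: "x \<in> {0..t}" for x
    proof -
      have Mx: "\<bar>M x\<bar> < 1" "0 \<le> M x" using P x by (auto simp: PiE_iff)
      have dM: "(M has_real_derivative (1 - M x powr a)) (at x within {0..t})"
        by (rule has_field_derivative_subset[of _ _ _ "{0..}"]) (use P x in \<open>auto simp: a_def\<close>)
      have "((G \<circ> M) has_real_derivative (1 / (1 - \<bar>M x\<bar> powr a)) * (1 - M x powr a)) (at x within {0..t})"
        by (rule DERIV_chain[OF Gd dM]) (use Mx in auto)
      then have "((G \<circ> M) has_real_derivative 1) (at x within {0..t})"
        using Mx lt1[of "M x"] by simp
      from DERIV_diff[OF this DERIV_ident] show ?thesis by (simp add: o_def)
    qed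
    obtain c where "\<And>x. x \<in> {0..t} \<Longrightarrow> G (M x) - x = c"
      using has_field_derivative_zero_constant[OF convex_real_interval(5) d] by blast
    from this[of 0] this[of t] show ?thesis using P t G0 by auto
  qed
  have dM0: "(M0 has_real_derivative (1 - M0 t powr a)) (at t)" if t: "0 < t" for t
  proof -
    have m: "0 \<le> M0 t" "M0 t < 1" "G (M0 t) = t" using M0[of t] t by auto
    have mpos: "0 < M0 t" using m G0 t by (cases "M0 t = 0") auto
    define b where "b = (1 + M0 t) / 2"
    have b: "M0 t < b" "b < 1" using m by (auto simp: b_def)
    have 1: "isCont M0 (G (M0 t))"
    proof (rule isCont_inverse_function2[where f = G and g = M0 and a = 0 and b = b])
      show "M0 (G z) = z" "isCont G z" if "0 \<le> z" "z \<le> b" for z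
        using that b M0G[of z] Gcont[of z] by auto
    qed (use mpos b in auto)
    have "(M0 has_real_derivative inverse (1 / (1 - \<bar>M0 t\<bar> powr a))) (at t)"
    proof (rule DERIV_inverse_function[where f = G and a = 0 and b = "t + 1"])
      show "(G has_real_derivative 1 / (1 - \<bar>M0 t\<bar> powr a)) (at (M0 t))" using Gd[of "M0 t"] m by simp
      show "1 / (1 - \<bar>M0 t\<bar> powr a) \<noteq> 0" using lt1[of "M0 t"] m by auto
      show "isCont M0 t" using 1 m by simp
      show "G (M0 y) = y" if "0 < y" "y < t + 1" for y using M0[of y] that by auto
    qed (use t in auto)
    then show ?thesis using m by simp
  qed
  have M00: "M0 0 = 0" using M0G[of 0] G0 by simp
  \<comment> \<open>The inverse function theorem does not apply here, because \<open>M0\<close>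
    inverts G only on nonnegative arguments. The one-sided quotient M0 x / x is instead m / G m at m
    = M0 x, which tends to 1 since G has derivative 1 at 0.\<close>
  have dM0_0: "(M0 has_real_derivative 1) (at 0 within {0..})"
  proof -
    have lim: "((\<lambda>m. G m / m) \<longlongrightarrow> 1) (at 0)"
      using Gd[of 0] a G0 by (simp add: has_field_derivative_iff)
    then have lim': "((\<lambda>m. m / G m) \<longlongrightarrow> 1) (at 0)"
      using tendsto_inverse[OF lim] by simp
    have lip: "M0 t \<le> t" if "0 \<le> t" for t
    proof -
      have "M0 t \<le> - ln (1 - M0 t)"
        using ln_le_minus_one[of "1 - M0 t"] M0[OF that] by auto
      also have "\<dots> \<le> G (M0 t)" using Glower M0[OF that] by blast
      finally show ?thesis using M0[OF that] by simp
    qed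
    have pos: "M0 t > 0" if "t > 0" for t using M0[of t] that G0 by (cases "M0 t = 0") auto
    have e: "eventually (\<lambda>x. x \<in> {0<..}) (at (0::real) within {0..})"
      by (auto simp: eventually_at_filter intro: always_eventually)
    have "filterlim M0 (at 0) (at 0 within {0..})"
      unfolding filterlim_at
    proof
      show "\<forall>\<^sub>F x in at 0 within {0..}. M0 x \<in> UNIV \<and> M0 x \<noteq> 0"
        using e by eventually_elim (use pos in force)
      show "(M0 \<longlongrightarrow> 0) (at 0 within {0..})"
      proof (rule tendsto_sandwich[of "\<lambda>_. 0" _ _ "\<lambda>x. x"])
        show "\<forall>\<^sub>F x in at 0 within {0..}. 0 \<le> M0 x"
          using e by eventually_elim (use M0 in force)
        show "\<forall>\<^sub>F x in at 0 within {0..}. M0 x \<le> x"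
          using e by eventually_elim (use lip in force)
      qed (auto intro!: tendsto_eq_intros)
    qed
    from filterlim_compose[OF lim' this]
    have "((\<lambda>x. M0 x / G (M0 x)) \<longlongrightarrow> 1) (at 0 within {0..})" .
    then have "((\<lambda>x. M0 x / x) \<longlongrightarrow> 1) (at 0 within {0..})"
      by (rule Lim_transform_eventually) (use e in \<open>eventually_elim, use M0 in force\<close>)
    then show ?thesis by (simp add: has_field_derivative_iff M00)
  qed
  have PM1: "?P M1"
  proof (intro conjI allI impI)
    show "M1 \<in> {0..} \<rightarrow>\<^sub>E {0..<1}" using M0 by (auto simp: M1_def)
    show "M1 0 = 0" by (simp add: M1_def M00)
    fix t :: real assume t: "0 \<le> t"
    have "(M0 has_real_derivative (1 - M0 t powr a)) (at t within {0..})"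
    proof (cases "t = 0")
      case True then show ?thesis using dM0_0 M00 a by simp
    next
      case False
      with t dM0[of t] show ?thesis by (simp add: has_field_derivative_at_within)
    qed
    then have "(M1 has_real_derivative (1 - M0 t powr a)) (at t within {0..})"
      by (rule has_field_derivative_transform_within[of _ _ _ _ 1]) (use t in \<open>auto simp: M1_def\<close>)
    then show "(M1 has_real_derivative (1 - M1 t powr (2 / real n))) (at t within {0..})"
      using t by (simp add: M1_def a_def)
  qed
  have uniq: "M = M1" if P: "?P M" for M
  proof
    fix t
    show "M t = M1 t"
    proof (cases "0 \<le> t")
      case True
      then have "M t \<in> {0..<1}" using P by (auto simp: PiE_iff)
      moreover have "G (M t) = G (M0 t)" using GM[OF P True] M0[OF True] by simp
      ultimately show ?thesis using True M0[OF True] by (auto simp: M1_def) (rule Ginj; auto)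
    next
      case False
      then show ?thesis using P by (auto simp: M1_def PiE_iff extensional_def)
    qed
  qed
  have prof: "profile n = M1"
    unfolding profile_def by (rule the_equality) (use PM1 in blast, use uniq in blast)
  show thesis
  proof (rule that[of G])
    show "G 0 = 0" by fact
    show "(G has_real_derivative 1 / (1 - m powr (2 / n))) (at m)" if "0 \<le> m" "m < 1" for m
      using Gd[of m] that by (simp add: a_def)
    show "profile n (G m) = m" if "0 \<le> m" "m < 1" for m
    proof -
      have "0 \<le> G m" using Gnonneg[OF that] .
      then show ?thesis using M0G[OF that] by (simp add: prof M1_def)
    qed
    show "0 \<le> profile n t \<and> profile n t < 1 \<and> G (profile n t) = t" if "0 \<le> t" for t
      using M0[OF that] that by (simp add: prof M1_def)
    show "0 < profile n t" if "0 < t" for t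
      using M0[of t] that G0 by (cases "M0 t = 0") (auto simp: prof M1_def)
    show "(profile n has_real_derivative (1 - profile n t powr (2 / n))) (at t)" if t: "0 < t" for t
    proof -
      have "(M1 has_real_derivative (1 - M0 t powr a)) (at t)"
        by (rule has_field_derivative_transform_within[OF dM0[OF t] t])
          (auto simp: M1_def dist_real_def)
      then show ?thesis using t by (simp add: prof M1_def a_def)
    qed
    show "profile n 0 = 0" by (simp add: prof M1_def M00)
  qed
qed

lemma profile_0: "n \<ge> 2 \<Longrightarrow> profile n 0 = 0"
  by (rule profile_inverse)

lemma profile_pos: "n \<ge> 2 \<Longrightarrow> 0 < t \<Longrightarrow> 0 < profile n t"
  by (rule profile_inverse[of n]) simp_all

lemma profile_less_1: "n \<ge> 2 \<Longrightarrow> 0 \<le> t \<Longrightarrow> profile n t < 1"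
  by (rule profile_inverse[of n]) simp_all

lemma profile_has_real_derivative:
  "n \<ge> 2 \<Longrightarrow> 0 < t \<Longrightarrow> (profile n has_real_derivative (1 - profile n t powr (2 / n))) (at t)"
  by (rule profile_inverse[of n]) simp_all

section \<open>Integrals depending on a parameter\<close>

text \<open>The Lipschitz bound dominates all difference quotients by \<open>B\<close>, so dominated
  convergence applies along every sequence tending to \<open>t0\<close>.\<close>

lemma has_real_derivative_integral:
  fixes f :: "real \<Rightarrow> 'a \<Rightarrow> real"
  assumes "\<delta> > 0"
    and int: "\<And>t. \<bar>t - t0\<bar> < \<delta> \<Longrightarrow> integrable M (f t)"
    and der: "AE z in M. ((\<lambda>t. f t z) has_real_derivative f' z) (at t0)"
    and lip: "\<And>t. \<bar>t - t0\<bar> < \<delta> \<Longrightarrow> AE z in M. \<bar>f t z - f t0 z\<bar> \<le> B z * \<bar>t - t0\<bar>"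
    and B: "integrable M B"
    and f': "f' \<in> borel_measurable M"
  shows "((\<lambda>t. LINT z|M. f t z) has_real_derivative (LINT z|M. f' z)) (at t0)"
  unfolding has_field_derivative_iff tendsto_at_iff_sequentially
proof (intro allI impI)
  fix X :: "nat \<Rightarrow> real"
  assume X: "\<forall>i. X i \<in> UNIV - {t0}" "X \<longlonglongrightarrow> t0"
  \<comment> \<open>The hypotheses control only |t - t0| < \<delta>, so the sequence is shifted past
    its first N terms; \<open>LIMSEQ_offset\<close> undoes the shift at the end.\<close>
  then obtain N where N: "\<And>i. i \<ge> N \<Longrightarrow> \<bar>X i - t0\<bar> < \<delta>"
    using LIMSEQ_D[OF X(2) \<open>\<delta> > 0\<close>] by auto
  define Y where "Y i = X (i + N)" for i
  have Y: "Y i \<noteq> t0" "\<bar>Y i - t0\<bar> < \<delta>" for i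
    using X N by (auto simp: Y_def)
  have Ylim: "Y \<longlonglongrightarrow> t0"
    unfolding Y_def by (rule LIMSEQ_ignore_initial_segment[OF X(2)])
  have i0: "integrable M (f t0)" using int[of t0] \<open>\<delta> > 0\<close> by simp
  have "(\<lambda>i. LINT z|M. (f (Y i) z - f t0 z) / (Y i - t0)) \<longlonglongrightarrow> (LINT z|M. f' z)"
  proof (rule integral_dominated_convergence[where w = B])
    show "(\<lambda>z. (f (Y i) z - f t0 z) / (Y i - t0)) \<in> borel_measurable M" for i
      using int[OF Y(2)] i0 by (intro borel_measurable_divide borel_measurable_diff) auto
    show "AE z in M. (\<lambda>i. (f (Y i) z - f t0 z) / (Y i - t0)) \<longlonglongrightarrow> f' z"
      using der
    proof eventually_elim
      case (elim z)
      then have "((\<lambda>t. (f t z - f t0 z) / (t - t0)) \<longlongrightarrow> f' z) (at t0)"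
        by (simp add: has_field_derivative_iff)
      then show ?case
        using Y Ylim unfolding tendsto_at_iff_sequentially by (auto simp: o_def)
    qed
    show "AE z in M. norm ((f (Y i) z - f t0 z) / (Y i - t0)) \<le> B z" for i
      using lip[OF Y(2)[of i]]
    proof eventually_elim
      case (elim z)
      then show ?case using Y[of i] by (simp add: divide_le_eq abs_divide)
    qed
  qed (use B f' in auto)
  also have "(\<lambda>i. LINT z|M. (f (Y i) z - f t0 z) / (Y i - t0)) =
      (\<lambda>i. ((LINT z|M. f (Y i) z) - (LINT z|M. f t0 z)) / (Y i - t0))"
    using int[OF Y(2)] i0 by (simp add: Bochner_Integration.integral_diff)
  finally have "(\<lambda>i. ((\<lambda>t. ((LINT z|M. f t z) - (LINT z|M. f t0 z)) / (t - t0)) \<circ> X) (i + N))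
      \<longlonglongrightarrow> (LINT z|M. f' z)"
    by (simp add: Y_def o_def)
  then show "((\<lambda>t. ((LINT z|M. f t z) - (LINT z|M. f t0 z)) / (t - t0)) \<circ> X) \<longlonglongrightarrow> (LINT z|M. f' z)"
    by (rule LIMSEQ_offset)
qed

lemma set_integrable_weighted:
  fixes g \<rho> :: "'a::euclidean_space \<Rightarrow> real"
  assumes K: "compact K" and g: "continuous_on K g"
    and \<rho>: "\<rho> \<in> borel_measurable lebesgue" "\<And>z. \<bar>\<rho> z\<bar> \<le> 1"
  shows "set_integrable lebesgue K (\<lambda>z. \<rho> z * g z)"
proof -
  have Ks: "K \<in> sets borel" using K by (simp add: borel_compact)
  have Ki: "integrable lebesgue (indicator K :: 'a \<Rightarrow> real)"
    using lmeasurable_compact[OF K] by (intro integrable_real_indicator) (simp_all only: fmeasurable_def mem_Collect_eq infinity_ennreal_def)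
  obtain b where b: "\<And>z. z \<in> K \<Longrightarrow> \<bar>g z\<bar> \<le> b"
    using compact_imp_bounded[OF compact_continuous_image[OF g K]] unfolding bounded_iff by force
  have "(\<lambda>z. indicator K z *\<^sub>R g z) \<in> borel_measurable borel"
    using borel_measurable_continuous_on_indicator[OF Ks g] .
  then have m: "(\<lambda>z. indicator K z *\<^sub>R g z) \<in> borel_measurable lebesgue"
    by (intro measurable_completion) auto
  show ?thesis
    unfolding set_integrable_def
  proof (rule Bochner_Integration.integrable_bound)
    show "integrable lebesgue (\<lambda>z. b * indicator K z :: real)" using Ki by simp
    have "(\<lambda>z. \<rho> z * (indicator K z *\<^sub>R g z)) \<in> borel_measurable lebesgue"
      using m \<rho> by (intro borel_measurable_times)
    then show "(\<lambda>z. indicator K z *\<^sub>R (\<rho> z * g z)) \<in> borel_measurable lebesgue"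
      by (simp add: mult_ac)
    show "AE z in lebesgue. norm (indicator K z *\<^sub>R (\<rho> z * g z)) \<le> norm (b * indicator K z :: real)"
    proof (rule AE_I2)
      fix z
      show "norm (indicator K z *\<^sub>R (\<rho> z * g z)) \<le> norm (b * indicator K z :: real)"
        using b[of z] \<rho>(2)[of z] mult_mono[of "\<bar>\<rho> z\<bar>" 1 "\<bar>g z\<bar>" b]
        by (auto simp: indicator_def abs_mult)
    qed
  qed
qed

text \<open>The Lipschitz constant required for domination is a bound of k' on the compact product
  of the parameter interval and K, by the mean value inequality. The weight \<rho> is only
  measurable and bounded; all regularity is in the kernel.\<close>

lemma has_real_derivative_set_integral:
  fixes k k' :: "real \<Rightarrow> 'a::euclidean_space \<Rightarrow> real"
  assumes K: "compact K" and \<delta>: "\<delta> > 0"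
    and \<rho>: "\<rho> \<in> borel_measurable lebesgue" "\<And>z. \<bar>\<rho> z\<bar> \<le> (1::real)"
    and der: "\<And>t z. \<bar>t - t0\<bar> \<le> \<delta> \<Longrightarrow> z \<in> K \<Longrightarrow> ((\<lambda>t. k t z) has_real_derivative k' t z) (at t)"
    and k: "\<And>t. \<bar>t - t0\<bar> \<le> \<delta> \<Longrightarrow> continuous_on K (k t)"
    and k': "continuous_on (cball t0 \<delta> \<times> K) (\<lambda>(t, z). k' t z)"
  shows "((\<lambda>t. LINT z:K|lebesgue. \<rho> z * k t z) has_real_derivative
           (LINT z:K|lebesgue. \<rho> z * k' t0 z)) (at t0)"
proof -
  have "compact (cball t0 \<delta> \<times> K)" using K by (intro compact_Times) auto
  from compact_imp_bounded[OF compact_continuous_image[OF k' this]]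
  obtain b where b: "\<And>t z. \<bar>t - t0\<bar> \<le> \<delta> \<Longrightarrow> z \<in> K \<Longrightarrow> \<bar>k' t z\<bar> \<le> b"
    unfolding bounded_iff by (force simp: dist_real_def abs_minus_commute)
  have lip: "\<bar>k t z - k t0 z\<bar> \<le> b * \<bar>t - t0\<bar>" if "\<bar>t - t0\<bar> \<le> \<delta>" "z \<in> K" for t z
  proof -
    have "norm (k t z - k t0 z) \<le> b * norm (t - t0)"
    proof (rule field_differentiable_bound[where S = "cball t0 \<delta>" and f' = "\<lambda>t. k' t z"])
      fix s assume "s \<in> cball t0 \<delta>"
      then have "\<bar>s - t0\<bar> \<le> \<delta>" by (simp add: dist_real_def abs_minus_commute)
      then show "((\<lambda>t. k t z) has_field_derivative k' s z) (at s within cball t0 \<delta>)"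
          "norm (k' s z) \<le> b"
        using der b that by (auto intro: has_field_derivative_at_within)
    qed (use that \<delta> in \<open>auto simp: dist_real_def abs_minus_commute\<close>)
    then show ?thesis by simp
  qed
  have k't0: "continuous_on K (k' t0)"
  proof -
    have "continuous_on K ((\<lambda>(t, z). k' t z) \<circ> (\<lambda>z. (t0, z)))"
      by (rule continuous_on_compose)
        (use \<delta> in \<open>auto intro!: continuous_intros continuous_on_subset[OF k']\<close>)
    then show ?thesis by (simp add: o_def)
  qed
  have i1: "set_integrable lebesgue K (\<lambda>z. \<rho> z * k t z)" if "\<bar>t - t0\<bar> \<le> \<delta>" for t
    by (rule set_integrable_weighted[OF K k[OF that] \<rho>])
  have i2: "set_integrable lebesgue K (\<lambda>z. \<rho> z * k' t0 z)"
    by (rule set_integrable_weighted[OF K k't0 \<rho>])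
  have i3: "set_integrable lebesgue K (\<lambda>z. \<bar>\<rho> z\<bar> * b)"
    by (rule set_integrable_weighted[OF K]) (use \<rho> in auto)
  show ?thesis
    unfolding set_lebesgue_integral_def
  proof (rule has_real_derivative_integral[OF \<delta>, where B = "\<lambda>z. indicator K z *\<^sub>R (\<bar>\<rho> z\<bar> * b)"])
    show "integrable lebesgue (\<lambda>z. indicat_real K z *\<^sub>R (\<rho> z * k t z))" if "\<bar>t - t0\<bar> < \<delta>" for t
      using i1[of t] that by (simp add: set_integrable_def)
    show "AE z in lebesgue. ((\<lambda>t. indicat_real K z *\<^sub>R (\<rho> z * k t z)) has_real_derivative
        indicat_real K z *\<^sub>R (\<rho> z * k' t0 z)) (at t0)"
    proof (rule AE_I2)
      fix z show "((\<lambda>t. indicat_real K z *\<^sub>R (\<rho> z * k t z)) has_real_derivative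
        indicat_real K z *\<^sub>R (\<rho> z * k' t0 z)) (at t0)"
        using der[of t0 z] \<delta> by (cases "z \<in> K") (auto intro: DERIV_cmult)
    qed
    show "AE z in lebesgue. \<bar>indicat_real K z *\<^sub>R (\<rho> z * k t z) - indicat_real K z *\<^sub>R (\<rho> z * k t0 z)\<bar>
        \<le> indicat_real K z *\<^sub>R (\<bar>\<rho> z\<bar> * b) * \<bar>t - t0\<bar>" if "\<bar>t - t0\<bar> < \<delta>" for t
    proof (rule AE_I2)
      fix z
      show "\<bar>indicat_real K z *\<^sub>R (\<rho> z * k t z) - indicat_real K z *\<^sub>R (\<rho> z * k t0 z)\<bar>
        \<le> indicat_real K z *\<^sub>R (\<bar>\<rho> z\<bar> * b) * \<bar>t - t0\<bar>"
        using lip[of t z] that mult_left_mono[of "\<bar>k t z - k t0 z\<bar>" "b * \<bar>t - t0\<bar>" "\<bar>\<rho> z\<bar>"]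
        by (cases "z \<in> K") (auto simp: abs_mult right_diff_distrib[symmetric] mult_ac)
    qed
  qed (use i2 i3 in \<open>auto simp: set_integrable_def\<close>)
qed

lemma continuous_on_set_integral:
  fixes k :: "'b::{metric_space,heine_borel} \<Rightarrow> 'a::euclidean_space \<Rightarrow> real"
  assumes K: "compact K" and X: "compact X"
    and \<rho>: "\<rho> \<in> borel_measurable lebesgue" "\<And>z. \<bar>\<rho> z\<bar> \<le> (1::real)"
    and k: "continuous_on (X \<times> K) (\<lambda>(x, z). k x z)"
  shows "continuous_on X (\<lambda>x. LINT z:K|lebesgue. \<rho> z * k x z)"
  unfolding continuous_on_sequentially
proof (intro allI ballI impI)
  fix Y a assume a: "a \<in> X" and Y: "(\<forall>n. Y n \<in> X) \<and> Y \<longlonglongrightarrow> a"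
  from compact_imp_bounded[OF compact_continuous_image[OF k compact_Times[OF X K]]]
  obtain b where b: "\<And>x z. x \<in> X \<Longrightarrow> z \<in> K \<Longrightarrow> \<bar>k x z\<bar> \<le> b"
    unfolding bounded_iff by force
  have kx: "continuous_on K (k x)" if "x \<in> X" for x
  proof -
    have "continuous_on K ((\<lambda>(x, z). k x z) \<circ> (\<lambda>z. (x, z)))"
      by (rule continuous_on_compose)
        (use that in \<open>auto intro!: continuous_intros continuous_on_subset[OF k]\<close>)
    then show ?thesis by (simp add: o_def)
  qed
  have i: "set_integrable lebesgue K (\<lambda>z. \<rho> z * k x z)" if "x \<in> X" for x
    by (rule set_integrable_weighted[OF K kx[OF that] \<rho>])
  have i3: "set_integrable lebesgue K (\<lambda>z. \<bar>\<rho> z\<bar> * b)"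
    by (rule set_integrable_weighted[OF K]) (use \<rho> in auto)
  show "((\<lambda>x. LINT z:K|lebesgue. \<rho> z * k x z) \<circ> Y) \<longlonglongrightarrow> (LINT z:K|lebesgue. \<rho> z * k a z)"
    unfolding o_def set_lebesgue_integral_def
  proof (rule integral_dominated_convergence[where w = "\<lambda>z. indicator K z *\<^sub>R (\<bar>\<rho> z\<bar> * b)"])
    show "AE z in lebesgue. (\<lambda>i. indicat_real K z *\<^sub>R (\<rho> z * k (Y i) z)) \<longlonglongrightarrow> indicat_real K z *\<^sub>R (\<rho> z * k a z)"
    proof (rule AE_I2)
      fix z show "(\<lambda>i. indicat_real K z *\<^sub>R (\<rho> z * k (Y i) z)) \<longlonglongrightarrow> indicat_real K z *\<^sub>R (\<rho> z * k a z)"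
      proof (cases "z \<in> K")
        case True
        have "(\<lambda>i. (Y i, z)) \<longlonglongrightarrow> (a, z)" using Y by (intro tendsto_intros) auto
        then have "(\<lambda>i. k (Y i) z) \<longlonglongrightarrow> k a z"
          using k Y a True unfolding continuous_on_sequentially
          by (auto simp: o_def dest!: bspec[where x = "(a, z)"] spec[where x = "\<lambda>i. (Y i, z)"])
        then show ?thesis by (intro tendsto_intros)
      qed auto
    qed
    show "AE z in lebesgue. norm (indicat_real K z *\<^sub>R (\<rho> z * k (Y i) z)) \<le> indicat_real K z *\<^sub>R (\<bar>\<rho> z\<bar> * b)" for i
    proof (rule AE_I2)
      fix z
      show "norm (indicat_real K z *\<^sub>R (\<rho> z * k (Y i) z)) \<le> indicat_real K z *\<^sub>R (\<bar>\<rho> z\<bar> * b)"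
        using b[of "Y i" z] Y by (cases "z \<in> K") (auto simp: abs_mult mult_left_mono)
    qed
    show "(\<lambda>z. indicat_real K z *\<^sub>R (\<rho> z * k a z)) \<in> borel_measurable lebesgue"
      using i[OF a] by (auto simp: set_integrable_def)
    show "(\<lambda>z. indicat_real K z *\<^sub>R (\<rho> z * k (Y j) z)) \<in> borel_measurable lebesgue" for j
      using i[of "Y j"] Y by (auto simp: set_integrable_def)
    show "integrable lebesgue (\<lambda>z. indicat_real K z *\<^sub>R (\<bar>\<rho> z\<bar> * b))"
      using i3 by (simp add: set_integrable_def)
  qed
qed

section \<open>A divergence theorem on the unit ball\<close>

text \<open>The potentials are integrals for \<open>lebesgue\<close>, whereas translations and
  scalings are applied to \<open>lborel\<close>; this passes between the two.\<close>

lemma set_integral_lebesgue_eq_lborel: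
  fixes g :: "'a::euclidean_space \<Rightarrow> real"
  assumes "compact K" "continuous_on K g"
  shows "(LINT z:K|lebesgue. g z) = (LINT z|lborel. indicator K z * g z)"
    and "(\<lambda>z. indicator K z * g z) \<in> borel_measurable borel"
proof -
  have m: "(\<lambda>z. indicator K z *\<^sub>R g z) \<in> borel_measurable borel"
    using assms by (intro borel_measurable_continuous_on_indicator) (auto simp: borel_compact)
  then show "(\<lambda>z. indicator K z * g z) \<in> borel_measurable borel" by simp
  show "(LINT z:K|lebesgue. g z) = (LINT z|lborel. indicator K z * g z)"
    unfolding set_lebesgue_integral_def using m by (subst integral_completion) auto
qed

text \<open>Moving a ball to the unit ball turns its centre and radius into parameters of the
  integrand, so that the integral can be differentiated in the radius.\<close>

lemma set_integral_cball_affine: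
  fixes g :: "'a::euclidean_space \<Rightarrow> real"
  assumes s: "0 < s" and g: "continuous_on (cball b s) g"
  shows "(LINT z:cball b s|lebesgue. g z) =
    s ^ DIM('a) * (LINT y:cball 0 1|lebesgue. g (b + s *\<^sub>R y))"
proof -
  have mem: "b + s *\<^sub>R y \<in> cball b s \<longleftrightarrow> y \<in> cball 0 1" for y
    using s by (simp add: dist_norm mult_le_cancel_left1 field_simps)
  have g': "continuous_on (cball 0 1) (\<lambda>y. g (b + s *\<^sub>R y))"
    by (rule continuous_on_compose2[OF g]) (use mem in \<open>auto intro!: continuous_intros\<close>)
  have m: "(\<lambda>z. indicator (cball b s) z * g z) \<in> borel_measurable borel"
    by (rule set_integral_lebesgue_eq_lborel(2)[OF _ g]) simp
  have "(LINT z:cball b s|lebesgue. g z) = (LINT z|lborel. indicator (cball b s) z * g z)"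
    by (rule set_integral_lebesgue_eq_lborel(1)[OF _ g]) simp
  also have "\<dots> = (LINT z|density (distr lborel borel (\<lambda>x. b + s *\<^sub>R x)) (\<lambda>_. ennreal (\<bar>s\<bar> ^ DIM('a))).
      indicator (cball b s) z * g z)"
    using s by (subst lborel_affine[of s b]) auto
  also have "\<dots> = (LINT z|distr lborel borel (\<lambda>x. b + s *\<^sub>R x).
      (\<bar>s\<bar> ^ DIM('a)) *\<^sub>R (indicator (cball b s) z * g z))"
    using m by (subst integral_density) auto
  also have "\<dots> = (LINT y|lborel. (\<bar>s\<bar> ^ DIM('a)) *\<^sub>R (indicator (cball b s) (b + s *\<^sub>R y) * g (b + s *\<^sub>R y)))"
    using m by (subst integral_distr) auto
  also have "\<dots> = (LINT y|lborel. s ^ DIM('a) * (indicator (cball 0 1) y * g (b + s *\<^sub>R y)))"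
    using s mem by (intro Bochner_Integration.integral_cong) (auto simp: indicator_def)
  also have "\<dots> = s ^ DIM('a) * (LINT y|lborel. indicator (cball 0 1) y * g (b + s *\<^sub>R y))"
    by simp
  also have "(LINT y|lborel. indicator (cball 0 1) y * g (b + s *\<^sub>R y)) =
      (LINT y:cball 0 1|lebesgue. g (b + s *\<^sub>R y))"
    by (rule set_integral_lebesgue_eq_lborel(1)[OF _ g', symmetric]) simp
  finally show ?thesis .
qed

text \<open>
  Extending \<open>f\<close> by the nearest-point retraction makes it globally Lipschitz, so that the integral
  of its difference quotients, which vanishes by translation invariance, passes to the limit.
\<close>

lemma integral_cball_directional_derivative:
  fixes f :: "'a::euclidean_space \<Rightarrow> real" and D :: "'a \<Rightarrow> 'a"
  assumes f: "\<And>y. y \<in> cball 0 1 \<Longrightarrow> (f has_derivative (\<lambda>v. D y \<bullet> v)) (at y)"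
    and D: "continuous_on (cball 0 1) D"
    and f0: "\<And>y. y \<in> sphere 0 1 \<Longrightarrow> f y = 0"
  shows "(LINT y:cball 0 1|lebesgue. D y \<bullet> e) = 0"
proof -
  define U where "U = cball (0::'a) 1"
  have U: "compact U" "closed U" "convex U" "U \<noteq> {}" by (auto simp: U_def)
  define p where "p = closest_point U"
  have pU: "p y \<in> U" for y unfolding p_def using U by (intro closest_point_in_set)
  have pself: "p y = y" if "y \<in> U" for y unfolding p_def using that by (rule closest_point_self)
  \<comment> \<open>Points outside the open unit ball are retracted onto the sphere, where f
    vanishes; so F is zero there and has compact support.\<close>
  have pfront: "p y \<in> sphere 0 1" if "1 \<le> norm y" for y
  proof -
    have "p y \<in> rel_frontier U"
      unfolding p_def
    proof (rule closest_point_in_rel_frontier)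
      show "y \<in> affine hull U - rel_interior U"
        using that by (auto simp: U_def affine_hull_nonempty_interior rel_interior_nonempty_interior)
    qed (use U in auto)
    then show ?thesis by (simp add: U_def rel_frontier_nonempty_interior)
  qed
  obtain L where L: "\<And>y. y \<in> U \<Longrightarrow> norm (D y) \<le> L"
    using compact_imp_bounded[OF compact_continuous_image[OF D]] unfolding bounded_iff U_def by force
  have L0: "0 \<le> L" using order_trans[OF norm_ge_zero L[of 0]] by (simp add: U_def)
  define F where "F = f \<circ> p"
  have lip: "\<bar>F x - F y\<bar> \<le> L * norm (x - y)" for x y
  proof -
    have "norm (f (p x) - f (p y)) \<le> L * norm (p x - p y)"
    proof (rule differentiable_bound[of U f "\<lambda>y v. D y \<bullet> v"])
      fix z assume z: "z \<in> U"
      show "(f has_derivative (\<lambda>v. D z \<bullet> v)) (at z within U)"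
        using f z by (auto simp: U_def intro: has_derivative_at_withinI)
      show "onorm (\<lambda>v. D z \<bullet> v) \<le> L"
      proof (rule onorm_le)
        fix v show "norm (D z \<bullet> v) \<le> L * norm v"
          using Cauchy_Schwarz_ineq2[of "D z" v] mult_right_mono[OF L[OF z] norm_ge_zero[of v]] by simp
      qed
    qed (use U pU in auto)
    also have "\<dots> \<le> L * norm (x - y)"
      using closest_point_lipschitz[OF U(3,2,4), of x y] L0
      by (intro mult_left_mono) (auto simp: p_def dist_norm)
    finally show ?thesis by (simp add: F_def)
  qed
  have F0: "F y = 0" if "1 \<le> norm y" for y
    using f0 pfront[OF that] by (auto simp: F_def)
  have Fcont: "continuous_on UNIV F"
  proof (rule lipschitz_on_continuous_on)
    show "L-lipschitz_on UNIV F"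
      using lip L0 by (auto simp: lipschitz_on_def dist_norm)
  qed
  have Fm: "F \<in> borel_measurable borel"
    using Fcont by (rule borel_measurable_continuous_onI)
  have Find: "F = (\<lambda>y. indicator U y * F y)"
    using F0 by (force simp: indicator_def U_def)
  have Fi: "integrable lborel F"
    by (subst Find) (rule borel_integrable_compact[OF U(1) continuous_on_subset[OF Fcont], simplified])
  define q where "q k y = (F (y + e /\<^sub>R real (Suc k)) - F y) * real (Suc k)" for k y
  have Fshift: "integrable lborel (\<lambda>y. F (y + v))" "(LINT y|lborel. F (y + v)) = (LINT y|lborel. F y)" for v
  proof -
    have "integrable (distr lborel borel ((+) v)) F" using Fi by (simp add: lborel_distr_plus)
    then show "integrable lborel (\<lambda>y. F (y + v))"
      using Fm by (subst (asm) integrable_distr_eq) (auto simp: add.commute)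
    have "(LINT y|lborel. F y) = (LINT y|distr lborel borel ((+) v). F y)" by (simp add: lborel_distr_plus)
    also have "\<dots> = (LINT y|lborel. F (y + v))"
      using Fm by (subst integral_distr) (auto simp: add.commute)
    finally show "(LINT y|lborel. F (y + v)) = (LINT y|lborel. F y)" by simp
  qed
  have q0: "(LINT y|lborel. q k y) = 0" for k
    unfolding q_def using Fshift[of "e /\<^sub>R real (Suc k)"] Fi by simp
  \<comment> \<open>The ball is enlarged by |e| because the shift e/(k + 1) can carry a point from
    outside into the unit ball. Farther out both values in the difference quotient are 0.\<close>
  define w where "w = (\<lambda>y. L * norm e * indicator (cball (0::'a) (1 + norm e)) y)"
  have De: "continuous_on U (\<lambda>y. D y \<bullet> e)"
    using D by (auto intro!: continuous_intros simp: U_def)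
  have "(\<lambda>k. LINT y|lborel. q k y) \<longlonglongrightarrow> (LINT y|lborel. indicator U y * (D y \<bullet> e))"
  proof (rule integral_dominated_convergence[where w = w])
    show "(\<lambda>y. indicator U y * (D y \<bullet> e)) \<in> borel_measurable lborel"
      using set_integral_lebesgue_eq_lborel(2)[OF U(1) De] by simp
    show "q k \<in> borel_measurable lborel" for k
      unfolding q_def using Fshift(1)[of "e /\<^sub>R real (Suc k)"] Fi by (intro borel_measurable_times borel_measurable_diff) auto
    show "integrable lborel w"
      unfolding w_def by (intro integrable_mult_right integrable_real_indicator emeasure_lborel_cball_finite) auto
    show "AE y in lborel. norm (q k y) \<le> w y" for k
    proof (rule AE_I2)
      fix y
      have s: "norm (e /\<^sub>R real (Suc k)) \<le> norm e"
        by (simp add: field_simps mult_left_le_one_le)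
      show "norm (q k y) \<le> w y"
      proof (cases "norm y \<le> 1 + norm e")
        case True
        have "\<bar>F (y + e /\<^sub>R real (Suc k)) - F y\<bar> \<le> L * (norm e / real (Suc k))"
          using lip[of "y + e /\<^sub>R real (Suc k)" y] by (simp add: divide_inverse mult.commute)
        then have "\<bar>F (y + e /\<^sub>R real (Suc k)) - F y\<bar> * real (Suc k) \<le> L * norm e"
          by (simp add: field_simps)
        then show ?thesis using True by (simp add: q_def w_def abs_mult)
      next
        case False
        have "norm y \<le> norm (y + e /\<^sub>R real (Suc k)) + norm (e /\<^sub>R real (Suc k))"
          using norm_triangle_ineq4[of "y + e /\<^sub>R real (Suc k)" "e /\<^sub>R real (Suc k)"] by simp
        then have "1 \<le> norm (y + e /\<^sub>R real (Suc k))" using False s by linarith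
        moreover have "1 \<le> norm y" using False norm_ge_zero[of e] by linarith
        ultimately show ?thesis using F0 L0 by (simp add: q_def w_def)
      qed
    qed
    have "sphere (0::'a) 1 \<in> null_sets lborel"
      using negligible_sphere[of "0::'a" 1] by (simp add: negligible_iff_null_sets null_sets_completion_iff)
    then have "AE y in lborel. y \<notin> sphere (0::'a) 1" by (rule AE_not_in)
    then show "AE y in lborel. (\<lambda>k. q k y) \<longlonglongrightarrow> indicator U y * (D y \<bullet> e)"
    proof eventually_elim
      case (elim y)
      have "(\<lambda>k. e /\<^sub>R real (Suc k)) \<longlonglongrightarrow> 0 *\<^sub>R e"
        by (intro tendsto_scaleR tendsto_const LIMSEQ_inverse_real_of_nat)
      then have "(\<lambda>k. y + e /\<^sub>R real (Suc k)) \<longlonglongrightarrow> y + 0 *\<^sub>R e"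
        by (intro tendsto_add tendsto_const)
      then have lim: "(\<lambda>k. y + e /\<^sub>R real (Suc k)) \<longlonglongrightarrow> y" by simp
      show ?case
      proof (cases "norm y < 1")
        case True
        have ev: "eventually (\<lambda>k. y + e /\<^sub>R real (Suc k) \<in> ball 0 1) sequentially"
          using topological_tendstoD[OF lim open_ball, of 0 1] True by simp
        have "(f has_derivative (\<lambda>v. D y \<bullet> v)) (at y)" using f True by simp
        then have 1: "((\<lambda>t. f (y + t *\<^sub>R e)) has_derivative (\<lambda>t. D y \<bullet> (t *\<^sub>R e))) (at 0)"
          by (intro has_derivative_compose[of "\<lambda>t. y + t *\<^sub>R e" "\<lambda>t. t *\<^sub>R e" 0 UNIV f])
            (auto intro!: derivative_eq_intros)
        then have "((\<lambda>t. f (y + t *\<^sub>R e)) has_real_derivative D y \<bullet> e) (at 0)"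
          by (simp add: has_field_derivative_def mult_commute_abs)
        then have "((\<lambda>h. (f (y + h *\<^sub>R e) - f y) / h) \<longlongrightarrow> D y \<bullet> e) (at 0)"
          by (simp add: has_field_derivative_iff)
        then have "(\<lambda>k. (f (y + inverse (real (Suc k)) *\<^sub>R e) - f y) / inverse (real (Suc k))) \<longlonglongrightarrow> D y \<bullet> e"
          unfolding tendsto_at_iff_sequentially
          by (auto simp: o_def dest!: spec[where x = "\<lambda>k. inverse (real (Suc k))"]
              intro: LIMSEQ_inverse_real_of_nat)
        then have "(\<lambda>k. q k y) \<longlonglongrightarrow> D y \<bullet> e"
        proof (rule Lim_transform_eventually)
          show "\<forall>\<^sub>F k in sequentially. (f (y + inverse (real (Suc k)) *\<^sub>R e) - f y) / inverse (real (Suc k)) = q k y"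
            using ev
          proof eventually_elim
            case (elim k)
            then show ?case using True pself by (simp add: q_def F_def U_def divide_inverse)
          qed
        qed
        then show ?thesis using True by (simp add: U_def)
      next
        case False
        then have y1: "1 < norm y" using elim by simp
        have "eventually (\<lambda>k. y + e /\<^sub>R real (Suc k) \<in> - cball 0 1) sequentially"
          using topological_tendstoD[OF lim, of "- cball 0 1"] y1 by (simp add: open_Compl)
        then have "eventually (\<lambda>k. q k y = 0) sequentially"
          by eventually_elim (use F0 y1 in \<open>simp add: q_def\<close>)
        then show ?thesis using y1 by (simp add: U_def tendsto_eventually)
      qed
    qed
  qed
  then have "(LINT y|lborel. indicator U y * (D y \<bullet> e)) = 0"
    using q0 LIMSEQ_unique[of "\<lambda>_. 0::real"] by simp
  then show ?thesis
    using set_integral_lebesgue_eq_lborel(1)[OF U(1) De] by (simp add: U_def)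
qed

lemma set_integrable_continuous_compact:
  fixes g :: "'a::euclidean_space \<Rightarrow> real"
  assumes "compact K" "continuous_on K g"
  shows "set_integrable lebesgue K g"
  using set_integrable_weighted[OF assms, of "\<lambda>_. 1"] by simp

text \<open>The vector field is X = g(y) (d + k y). Each component of (1 - |y|^2) X vanishes on the
  unit sphere, so its partial derivative integrates to 0, and the sum over the coordinates is the
  divergence of (1 - |y|^2) X. All fields used below are scalar multiples of an affine field of this
  kind.\<close>

lemma integral_cball_divergence:
  fixes g :: "'a::euclidean_space \<Rightarrow> real" and D :: "'a \<Rightarrow> 'a"
  assumes g: "\<And>y. y \<in> cball 0 1 \<Longrightarrow> (g has_derivative (\<lambda>v. D y \<bullet> v)) (at y)"
    and D: "continuous_on (cball 0 1) D"
  shows "(LINT y:cball 0 1|lebesgue. (1 - y \<bullet> y) * (D y \<bullet> (d + k *\<^sub>R y) + k * DIM('a) * g y)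
            - 2 * g y * (y \<bullet> (d + k *\<^sub>R y))) = 0"
proof -
  have gc: "continuous_on (cball 0 1) g"
    using g by (intro has_derivative_continuous_on) (auto intro: has_derivative_at_withinI)
  \<comment> \<open>The gradient of (1 - |y|^2) g(y) ((d + k y).e), the component of the weighted
    field in direction e.\<close>
  define E where "E e y = ((1 - y \<bullet> y) * ((d + k *\<^sub>R y) \<bullet> e)) *\<^sub>R D y + ((1 - y \<bullet> y) * g y * k) *\<^sub>R e
      - (2 * g y * ((d + k *\<^sub>R y) \<bullet> e)) *\<^sub>R y" for e y :: 'a
  have Ec: "continuous_on (cball 0 1) (E e)" for e
    unfolding E_def using gc D by (intro continuous_intros)
  have 1: "(LINT y:cball 0 1|lebesgue. E e y \<bullet> e) = 0" for e
  proof (rule integral_cball_directional_derivative[where f = "\<lambda>y. (1 - y \<bullet> y) * (g y * ((d + k *\<^sub>R y) \<bullet> e))"])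
    fix y :: 'a assume y: "y \<in> cball 0 1"
    show "((\<lambda>y. (1 - y \<bullet> y) * (g y * ((d + k *\<^sub>R y) \<bullet> e))) has_derivative (\<lambda>v. E e y \<bullet> v)) (at y)"
      by (rule derivative_eq_intros refl g[OF y])+
        (auto simp: E_def fun_eq_iff algebra_simps inner_commute)
  next
    fix y :: 'a assume "y \<in> sphere 0 1"
    then show "(1 - y \<bullet> y) * (g y * ((d + k *\<^sub>R y) \<bullet> e)) = 0" by (simp add: dot_square_norm)
  qed (rule Ec)
  have i: "integrable lebesgue (\<lambda>y. indicator (cball 0 1) y *\<^sub>R (E e y \<bullet> e))" for e
  proof -
    have "continuous_on (cball 0 1) (\<lambda>y. E e y \<bullet> e)" using Ec by (intro continuous_intros)
    then show ?thesis
      using set_integrable_continuous_compact[of "cball (0::'a) 1"] by (simp add: set_integrable_def)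
  qed
  have pw: "(\<Sum>e\<in>Basis. E e y \<bullet> e) = (1 - y \<bullet> y) * (D y \<bullet> (d + k *\<^sub>R y) + k * DIM('a) * g y)
            - 2 * g y * (y \<bullet> (d + k *\<^sub>R y))" for y
  proof -
    have "(\<Sum>e\<in>Basis. E e y \<bullet> e) = (\<Sum>e\<in>Basis. (1 - y \<bullet> y) * ((D y \<bullet> e) * ((d + k *\<^sub>R y) \<bullet> e))
        + (1 - y \<bullet> y) * g y * k - 2 * g y * ((y \<bullet> e) * ((d + k *\<^sub>R y) \<bullet> e)))"
      by (rule sum.cong) (auto simp: E_def inner_add_left inner_diff_left)
    also have "\<dots> = (1 - y \<bullet> y) * (D y \<bullet> (d + k *\<^sub>R y)) + DIM('a) * ((1 - y \<bullet> y) * g y * k)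
        - 2 * g y * (y \<bullet> (d + k *\<^sub>R y))"
      by (simp only: sum.distrib sum_subtractf sum_distrib_left[symmetric] euclidean_inner[symmetric] sum_constant) (simp add: mult_ac)
    finally show ?thesis by (simp add: algebra_simps)
  qed
  have "0 = (\<Sum>e\<in>Basis. LINT y:cball 0 1|lebesgue. E e y \<bullet> e)" using 1 by simp
  also have "\<dots> = (LINT y|lebesgue. (\<Sum>e\<in>Basis. indicator (cball 0 1) y *\<^sub>R (E e y \<bullet> e)))"
    unfolding set_lebesgue_integral_def by (rule Bochner_Integration.integral_sum[symmetric]) (rule i)
  also have "\<dots> = (LINT y:cball 0 1|lebesgue. (\<Sum>e\<in>Basis. E e y \<bullet> e))"
    unfolding set_lebesgue_integral_def by (simp add: scaleR_sum_right sum_distrib_left)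
  finally show ?thesis unfolding pw by simp
qed

section \<open>The potential of a ball\<close>

text \<open>The squared distance from the origin to the point c + s y of the ball with centre c and
  radius s, parametrised by y in the unit ball. The point at which the potential is evaluated is the
  origin; it lies outside the ball when |s| < |c|.\<close>

definition shifted_sq :: "'a::euclidean_space \<Rightarrow> real \<Rightarrow> 'a \<Rightarrow> real" where
  "shifted_sq c s y = (c + s *\<^sub>R y) \<bullet> (c + s *\<^sub>R y)"

lemma shifted_sq_pos:
  assumes "\<bar>s\<bar> < norm c" "y \<in> cball 0 1"
  shows "0 < shifted_sq c s y"
proof -
  have "norm (s *\<^sub>R y) \<le> \<bar>s\<bar>" using assms(2) by (simp add: mult_left_le)
  then have "c + s *\<^sub>R y \<noteq> 0"
    using assms(1) by (metis add_eq_0_iff leD norm_minus_cancel)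
  then show ?thesis by (simp add: shifted_sq_def)
qed

lemma shifted_sq_expand: "shifted_sq c s y = (norm c)\<^sup>2 + 2 * s * (c \<bullet> y) + s\<^sup>2 * (y \<bullet> y)"
  by (simp add: shifted_sq_def algebra_simps power2_norm_eq_inner inner_commute) (simp add: power2_eq_square)

lemma continuous_on_shifted_sq [continuous_intros]:
  "continuous_on A f \<Longrightarrow> continuous_on A g \<Longrightarrow> continuous_on A (\<lambda>p. shifted_sq c (f p) (g p))"
  unfolding shifted_sq_def by (intro continuous_intros)

lemma has_derivative_shifted_sq_powr:
  assumes "\<bar>s\<bar> < norm c" "y \<in> cball 0 1"
  shows "((\<lambda>y. shifted_sq c s y powr a) has_derivative
    (\<lambda>v. ((2 * a * s * shifted_sq c s y powr (a - 1)) *\<^sub>R (c + s *\<^sub>R y)) \<bullet> v)) (at y)"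
proof -
  have "(shifted_sq c s has_derivative (\<lambda>v. 2 * s * ((c + s *\<^sub>R y) \<bullet> v))) (at y)"
    unfolding shifted_sq_def
    by (rule derivative_eq_intros refl)+ (auto simp: fun_eq_iff algebra_simps inner_commute)
  from has_derivative_powr[OF this has_derivative_const[of a]] shifted_sq_pos[OF assms]
  show ?thesis
    by (auto simp: powr_diff fun_eq_iff field_simps inner_add_left elim!: has_derivative_eq_rhs)
qed

lemma has_real_derivative_shifted_sq_powr:
  assumes "\<bar>s\<bar> < norm c" "y \<in> cball 0 1"
  shows "((\<lambda>s. shifted_sq c s y powr a) has_real_derivative
    2 * a * shifted_sq c s y powr (a - 1) * (c \<bullet> y + s * (y \<bullet> y))) (at s)"
proof -
  have "((\<lambda>s. shifted_sq c s y) has_real_derivative 2 * (c \<bullet> y + s * (y \<bullet> y))) (at s)"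
    unfolding shifted_sq_expand
    by (rule derivative_eq_intros refl)+ (auto simp: algebra_simps)
  from DERIV_powr[OF this shifted_sq_pos[OF assms] DERIV_const[of a]]
  show ?thesis
    using shifted_sq_pos[OF assms] by (auto simp: powr_diff algebra_simps elim!: DERIV_cong)
qed

section \<open>Divergence identities for the kernels on a ball\<close>

locale ball_integrals =
  fixes c :: "'a::euclidean_space" and n :: real
  assumes n_def: "n = DIM('a)"
begin

abbreviation "R \<equiv> norm c"
text \<open>With z = c + s y, \<open>W\<close> is |z|^(-n), the kernel of the potential, and
  \<open>P\<close> is |z|^(-n-2), the kernel of A and B.\<close>

abbreviation "W s y \<equiv> shifted_sq c s y powr (- n / 2)"
abbreviation "P s y \<equiv> shifted_sq c s y powr (- n / 2 - 1)"
abbreviation "B \<equiv> cball (0::'a) 1"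

lemma P_W: "\<bar>s\<bar> < R \<Longrightarrow> y \<in> B \<Longrightarrow> W s y = shifted_sq c s y * P s y"
  using shifted_sq_pos[of s c y] by (simp add: powr_diff)

lemma continuous_on_powr_shifted_sq:
  "\<bar>s\<bar> < R \<Longrightarrow> continuous_on B (\<lambda>y. shifted_sq c s y powr a)"
  by (intro continuous_intros) (use shifted_sq_pos in force)

text \<open>Half of the gap R - |s| keeps all radii of the interval below R, so the kernels have no
  singularity there. The same interval serves for differentiating in the radius.\<close>

lemma continuous_on_powr_shifted_sq2:
  assumes "\<bar>s\<bar> < R"
  shows "continuous_on (cball s ((R - \<bar>s\<bar>) / 2) \<times> B) (\<lambda>p. shifted_sq c (fst p) (snd p) powr a)"
proof (intro continuous_intros ballI)
  fix p assume p: "p \<in> cball s ((R - \<bar>s\<bar>) / 2) \<times> B"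
  then have "\<bar>s - fst p\<bar> \<le> (R - \<bar>s\<bar>) / 2" by (auto simp: dist_real_def)
  moreover have "\<bar>fst p\<bar> \<le> \<bar>s\<bar> + \<bar>s - fst p\<bar>" by arith
  ultimately have "\<bar>fst p\<bar> < R" using assms by (simp add: field_simps)
  then show "shifted_sq c (fst p) (snd p) \<noteq> 0" using shifted_sq_pos[of "fst p" c "snd p"] p by force
qed

lemma set_integrable_B: "continuous_on B g \<Longrightarrow> set_integrable lebesgue B (g :: 'a \<Rightarrow> real)"
  by (intro set_integrable_continuous_compact) auto

text \<open>The field is |z|^(-n-2) z with z = c + s y, whose divergence in y is -2 s
  \<open>P\<close>. In (1 - |y|^2) div X - 2 y.X the terms with |y|^2 then cancel.\<close>

lemma divergence_P:
  assumes s: "\<bar>s\<bar> < R"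
  shows "(LINT y:B|lebesgue. P s y * (s + c \<bullet> y)) = 0"
proof -
  let ?D = "\<lambda>y. (2 * (- n / 2 - 1) * s * shifted_sq c s y powr (- n / 2 - 1 - 1)) *\<^sub>R (c + s *\<^sub>R y)"
  have "(LINT y:B|lebesgue. (1 - y \<bullet> y) * (?D y \<bullet> (c + s *\<^sub>R y) + s * DIM('a) * P s y)
            - 2 * P s y * (y \<bullet> (c + s *\<^sub>R y))) = 0" (is "?I = 0")
    by (rule integral_cball_divergence[OF has_derivative_shifted_sq_powr[OF s]])
      (auto intro!: continuous_intros continuous_on_powr_shifted_sq[OF s])
  also have "?I = (LINT y:B|lebesgue. (-2) * (P s y * (s + c \<bullet> y)))"
  proof (rule set_lebesgue_integral_cong)
    show "\<forall>y. y \<in> B \<longrightarrow> (1 - y \<bullet> y) * (?D y \<bullet> (c + s *\<^sub>R y) + s * DIM('a) * P s y)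
            - 2 * P s y * (y \<bullet> (c + s *\<^sub>R y)) = (-2) * (P s y * (s + c \<bullet> y))"
    proof (intro allI impI)
      fix y assume y: "y \<in> B"
      define z where "z = c + s *\<^sub>R y"
      define p where "p = P s y"
      define q where "q = shifted_sq c s y powr (- n / 2 - 1 - 1)"
      have "q * shifted_sq c s y = p"
        unfolding p_def q_def using shifted_sq_pos[OF s y] by (subst powr_diff) simp
      then have 1: "z \<bullet> z * q = p"
        by (simp add: shifted_sq_def z_def mult.commute)
      have 2: "((2 * (- n / 2 - 1) * s * q) *\<^sub>R z) \<bullet> z = - (n + 2) * s * (z \<bullet> z * q)"
        by (simp add: algebra_simps)
      have 3: "y \<bullet> z = c \<bullet> y + s * (y \<bullet> y)"
        by (simp add: z_def inner_add_right inner_commute)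
      show "(1 - y \<bullet> y) * (?D y \<bullet> (c + s *\<^sub>R y) + s * DIM('a) * P s y)
            - 2 * P s y * (y \<bullet> (c + s *\<^sub>R y)) = (-2) * (P s y * (s + c \<bullet> y))"
        unfolding p_def[symmetric] q_def[symmetric] z_def[symmetric] n_def[symmetric] 2 1 3
        by (simp add: algebra_simps)
    qed
  qed simp
  finally show ?thesis by (simp only: set_integral_mult_right)
qed

text \<open>The field is |c + s y|^(-n) y. With the field of \<open>divergence_weighted_P\<close> it
  accounts for the s-derivative of the Poisson kernel integral.\<close>

lemma divergence_W:
  assumes s: "\<bar>s\<bar> < R"
  shows "(LINT y:B|lebesgue. (1 - y \<bullet> y) * (n * W s y - n * s * P s y * (c \<bullet> y + s * (y \<bullet> y)))
      - 2 * W s y * (y \<bullet> y)) = 0"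
proof -
  let ?D = "\<lambda>y. (2 * (- n / 2) * s * shifted_sq c s y powr (- n / 2 - 1)) *\<^sub>R (c + s *\<^sub>R y)"
  have "(LINT y:B|lebesgue. (1 - y \<bullet> y) * (?D y \<bullet> (0 + 1 *\<^sub>R y) + 1 * real DIM('a) * W s y)
            - 2 * W s y * (y \<bullet> (0 + 1 *\<^sub>R y))) = 0"
    by (rule integral_cball_divergence[OF has_derivative_shifted_sq_powr[OF s]])
      (auto intro!: continuous_intros continuous_on_powr_shifted_sq[OF s])
  then show ?thesis by (simp add: n_def algebra_simps)
qed

text \<open>The field of \<open>divergence_P\<close> multiplied by R^2 - |s y|^2, the numerator of
  the Poisson kernel. Its divergence gains only the term from the gradient of this factor.\<close>

lemma divergence_weighted_P:
  assumes s: "\<bar>s\<bar> < R"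
  shows "(LINT y:B|lebesgue. (1 - y \<bullet> y) * (- 2 * s\<^sup>2 * P s y * (c \<bullet> y + s * (y \<bullet> y))
      - 2 * s * (R\<^sup>2 - s\<^sup>2 * (y \<bullet> y)) * P s y)
      - 2 * (R\<^sup>2 - s\<^sup>2 * (y \<bullet> y)) * P s y * (c \<bullet> y + s * (y \<bullet> y))) = 0"
proof -
  let ?D = "\<lambda>y. (- 2 * s\<^sup>2 * P s y) *\<^sub>R y + ((R\<^sup>2 - s\<^sup>2 * (y \<bullet> y)) *
     (2 * (- n / 2 - 1) * s * shifted_sq c s y powr (- n / 2 - 1 - 1))) *\<^sub>R (c + s *\<^sub>R y)"
  have d: "((\<lambda>y. (R\<^sup>2 - s\<^sup>2 * (y \<bullet> y)) * P s y) has_derivative (\<lambda>v. ?D y \<bullet> v)) (at y)" if "y \<in> B" for y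
    by (rule derivative_eq_intros refl has_derivative_shifted_sq_powr[OF s that])+
      (simp add: fun_eq_iff algebra_simps inner_commute)
  have "(LINT y:B|lebesgue. (1 - y \<bullet> y) * (?D y \<bullet> (c + s *\<^sub>R y) + s * DIM('a) * ((R\<^sup>2 - s\<^sup>2 * (y \<bullet> y)) * P s y))
            - 2 * ((R\<^sup>2 - s\<^sup>2 * (y \<bullet> y)) * P s y) * (y \<bullet> (c + s *\<^sub>R y))) = 0" (is "?I = 0")
    by (rule integral_cball_divergence[OF d])
      (auto intro!: continuous_intros continuous_on_powr_shifted_sq[OF s])
  also have "?I = (LINT y:B|lebesgue. (1 - y \<bullet> y) * (- 2 * s\<^sup>2 * P s y * (c \<bullet> y + s * (y \<bullet> y))
      - 2 * s * (R\<^sup>2 - s\<^sup>2 * (y \<bullet> y)) * P s y)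
      - 2 * (R\<^sup>2 - s\<^sup>2 * (y \<bullet> y)) * P s y * (c \<bullet> y + s * (y \<bullet> y)))"
  proof (rule set_lebesgue_integral_cong, simp, intro allI impI)
    fix y assume y: "y \<in> B"
    define z where "z = c + s *\<^sub>R y"
    define p where "p = P s y"
    define h where "h = R\<^sup>2 - s\<^sup>2 * (y \<bullet> y)"
    define q where "q = shifted_sq c s y powr (- n / 2 - 1 - 1)"
    have "q * shifted_sq c s y = p"
      unfolding p_def q_def using shifted_sq_pos[OF s y] by (subst powr_diff) simp
    then have 1: "z \<bullet> z * q = p"
      by (simp add: shifted_sq_def z_def mult.commute)
    have 2: "((- 2 * s\<^sup>2 * p) *\<^sub>R y + (h * (2 * (- n / 2 - 1) * s * q)) *\<^sub>R z) \<bullet> z =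
        - 2 * s\<^sup>2 * p * (y \<bullet> z) - h * (n + 2) * s * (z \<bullet> z * q)"
      by (simp add: algebra_simps)
    have 3: "y \<bullet> z = c \<bullet> y + s * (y \<bullet> y)"
      by (simp add: z_def inner_add_right inner_commute)
    show "(1 - y \<bullet> y) * (?D y \<bullet> (c + s *\<^sub>R y) + s * DIM('a) * ((R\<^sup>2 - s\<^sup>2 * (y \<bullet> y)) * P s y))
            - 2 * ((R\<^sup>2 - s\<^sup>2 * (y \<bullet> y)) * P s y) * (y \<bullet> (c + s *\<^sub>R y)) =
        (1 - y \<bullet> y) * (- 2 * s\<^sup>2 * P s y * (c \<bullet> y + s * (y \<bullet> y))
      - 2 * s * (R\<^sup>2 - s\<^sup>2 * (y \<bullet> y)) * P s y)
      - 2 * (R\<^sup>2 - s\<^sup>2 * (y \<bullet> y)) * P s y * (c \<bullet> y + s * (y \<bullet> y))"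
      unfolding p_def[symmetric] h_def[symmetric] n_def[symmetric] q_def[symmetric] z_def[symmetric] 2 1 3
      by (simp add: algebra_simps)
  qed
  finally show ?thesis .
qed

end

section \<open>Evaluation of the integrals over a ball\<close>

context ball_integrals
begin

lemma integrand_continuous:
  assumes s: "\<bar>s\<bar> < R"
  shows "set_integrable lebesgue B (\<lambda>y. (1 - y \<bullet> y) * P s y)"
    "set_integrable lebesgue B (\<lambda>y. (R\<^sup>2 + s * (c \<bullet> y)) * P s y)"
    "set_integrable lebesgue B (W s)"
    "set_integrable lebesgue B (\<lambda>y. P s y * (s + c \<bullet> y))"
    "set_integrable lebesgue B (\<lambda>y. P s y * (c \<bullet> y + s * (y \<bullet> y)))"
    "set_integrable lebesgue B (\<lambda>y. (R\<^sup>2 - s\<^sup>2 * (y \<bullet> y)) * W s y)"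
    "set_integrable lebesgue B (\<lambda>y. - 2 * s * (y \<bullet> y) * W s y
      - n * (R\<^sup>2 - s\<^sup>2 * (y \<bullet> y)) * P s y * (c \<bullet> y + s * (y \<bullet> y)))"
    "set_integrable lebesgue B (\<lambda>y. (1 - y \<bullet> y) * (n * W s y - n * s * P s y * (c \<bullet> y + s * (y \<bullet> y)))
      - 2 * W s y * (y \<bullet> y))"
    "set_integrable lebesgue B (\<lambda>y. (1 - y \<bullet> y) * (- 2 * s\<^sup>2 * P s y * (c \<bullet> y + s * (y \<bullet> y))
      - 2 * s * (R\<^sup>2 - s\<^sup>2 * (y \<bullet> y)) * P s y)
      - 2 * (R\<^sup>2 - s\<^sup>2 * (y \<bullet> y)) * P s y * (c \<bullet> y + s * (y \<bullet> y)))"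
proof -
  define w p where "w = W s" and "p = P s"
  have c: "continuous_on B w" "continuous_on B p"
    unfolding w_def p_def by (rule continuous_on_powr_shifted_sq[OF s])+
  have eq: "W s y = w y" "P s y = p y" for y by (simp_all add: w_def p_def)
  note i = set_integrable_B continuous_on_add continuous_on_diff continuous_on_mult continuous_on_const
    continuous_on_inner continuous_on_id c
  show "set_integrable lebesgue B (\<lambda>y. (1 - y \<bullet> y) * P s y)"
    unfolding eq by (intro i)
  show "set_integrable lebesgue B (\<lambda>y. (R\<^sup>2 + s * (c \<bullet> y)) * P s y)"
    unfolding eq by (intro i)
  show "set_integrable lebesgue B (W s)"
    unfolding eq by (intro i)
  show "set_integrable lebesgue B (\<lambda>y. P s y * (s + c \<bullet> y))"
    unfolding eq by (intro i)
  show "set_integrable lebesgue B (\<lambda>y. P s y * (c \<bullet> y + s * (y \<bullet> y)))"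
    unfolding eq by (intro i)
  show "set_integrable lebesgue B (\<lambda>y. (R\<^sup>2 - s\<^sup>2 * (y \<bullet> y)) * W s y)"
    unfolding eq by (intro i)
  show "set_integrable lebesgue B (\<lambda>y. - 2 * s * (y \<bullet> y) * W s y
      - n * (R\<^sup>2 - s\<^sup>2 * (y \<bullet> y)) * P s y * (c \<bullet> y + s * (y \<bullet> y)))"
    unfolding eq by (intro i)
  show "set_integrable lebesgue B (\<lambda>y. (1 - y \<bullet> y) * (n * W s y - n * s * P s y * (c \<bullet> y + s * (y \<bullet> y)))
      - 2 * W s y * (y \<bullet> y))"
    unfolding eq by (intro i)
  show "set_integrable lebesgue B (\<lambda>y. (1 - y \<bullet> y) * (- 2 * s\<^sup>2 * P s y * (c \<bullet> y + s * (y \<bullet> y))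
      - 2 * s * (R\<^sup>2 - s\<^sup>2 * (y \<bullet> y)) * P s y)
      - 2 * (R\<^sup>2 - s\<^sup>2 * (y \<bullet> y)) * P s y * (c \<bullet> y + s * (y \<bullet> y)))"
    unfolding eq by (intro i)
qed

text \<open>The integrands of the two sides differ by s \<open>P\<close> (s + c.y), which integrates
  to 0 by \<open>divergence_P\<close>. Up to the factor -s^n the left side is the integral over the
  comparison ball in \<open>bathtub\<close>.\<close>

lemma integral_defect:
  assumes s: "\<bar>s\<bar> < R"
  shows "s\<^sup>2 * (LINT y:B|lebesgue. (1 - y \<bullet> y) * P s y) =
    (LINT y:B|lebesgue. (R\<^sup>2 + s * (c \<bullet> y)) * P s y) - (LINT y:B|lebesgue. W s y)"
proof -
  note i = integrand_continuous[OF s]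
  have "s\<^sup>2 * (LINT y:B|lebesgue. (1 - y \<bullet> y) * P s y) =
      (LINT y:B|lebesgue. s\<^sup>2 * ((1 - y \<bullet> y) * P s y))" by simp
  also have "\<dots> = (LINT y:B|lebesgue. ((R\<^sup>2 + s * (c \<bullet> y)) * P s y - W s y) + s * (P s y * (s + c \<bullet> y)))"
  proof (rule set_lebesgue_integral_cong, simp, intro allI impI)
    fix y assume y: "y \<in> B"
    define p where "p = P s y"
    show "s\<^sup>2 * ((1 - y \<bullet> y) * P s y) = ((R\<^sup>2 + s * (c \<bullet> y)) * P s y - W s y) + s * (P s y * (s + c \<bullet> y))"
      unfolding P_W[OF s y] unfolding p_def[symmetric] unfolding shifted_sq_expand by (simp add: algebra_simps power2_eq_square)
  qed
  also have "\<dots> = (LINT y:B|lebesgue. (R\<^sup>2 + s * (c \<bullet> y)) * P s y) - (LINT y:B|lebesgue. W s y)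
      + s * (LINT y:B|lebesgue. P s y * (s + c \<bullet> y))"
    by (subst set_integral_add set_integral_diff; (intro set_integral_diff set_integrable_mult_right i)?)+ simp
  finally show ?thesis using divergence_P[OF s] by simp
qed

text \<open>The integrand is the s-derivative of (R^2 - |s y|^2) / |c + s y|^n. Multiplied by s it
  equals s^2 times the integrand of \<open>divergence_W\<close> plus n s / 2 times that of
  \<open>divergence_weighted_P\<close>; after W = |z|^2 P is inserted, the remaining terms with the
  factor 1 - |y|^2 cancel.\<close>

lemma integral_radial_derivative:
  assumes s: "\<bar>s\<bar> < R"
  shows "s * (LINT y:B|lebesgue. - 2 * s * (y \<bullet> y) * W s y
      - n * (R\<^sup>2 - s\<^sup>2 * (y \<bullet> y)) * P s y * (c \<bullet> y + s * (y \<bullet> y))) = 0"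
proof -
  note i = integrand_continuous[OF s]
  define e2 where "e2 = (\<lambda>y. (1 - y \<bullet> y) * (n * W s y - n * s * P s y * (c \<bullet> y + s * (y \<bullet> y)))
      - 2 * W s y * (y \<bullet> y))"
  define e3 where "e3 = (\<lambda>y. (1 - y \<bullet> y) * (- 2 * s\<^sup>2 * P s y * (c \<bullet> y + s * (y \<bullet> y))
      - 2 * s * (R\<^sup>2 - s\<^sup>2 * (y \<bullet> y)) * P s y)
      - 2 * (R\<^sup>2 - s\<^sup>2 * (y \<bullet> y)) * P s y * (c \<bullet> y + s * (y \<bullet> y)))"
  have i2: "set_integrable lebesgue B e2" "set_integrable lebesgue B e3"
    unfolding e2_def e3_def by (fact i)+
  have "s * (LINT y:B|lebesgue. - 2 * s * (y \<bullet> y) * W s y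
      - n * (R\<^sup>2 - s\<^sup>2 * (y \<bullet> y)) * P s y * (c \<bullet> y + s * (y \<bullet> y))) =
      (LINT y:B|lebesgue. s * (- 2 * s * (y \<bullet> y) * W s y
      - n * (R\<^sup>2 - s\<^sup>2 * (y \<bullet> y)) * P s y * (c \<bullet> y + s * (y \<bullet> y))))"
    by (rule set_integral_mult_right[symmetric])
  also have "\<dots> = (LINT y:B|lebesgue. s\<^sup>2 * e2 y + n * s / 2 * e3 y)"
  proof (rule set_lebesgue_integral_cong, simp, intro allI impI)
    fix y assume y: "y \<in> B"
    define p where "p = P s y"
    show "s * (- 2 * s * (y \<bullet> y) * W s y
      - n * (R\<^sup>2 - s\<^sup>2 * (y \<bullet> y)) * P s y * (c \<bullet> y + s * (y \<bullet> y))) = s\<^sup>2 * e2 y + n * s / 2 * e3 y"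
      unfolding e2_def e3_def P_W[OF s y] unfolding p_def[symmetric] unfolding shifted_sq_expand by (simp add: field_simps power2_eq_square)
  qed
  also have "\<dots> = s\<^sup>2 * (LINT y:B|lebesgue. e2 y) + n * s / 2 * (LINT y:B|lebesgue. e3 y)"
    using i2 by (subst set_integral_add(2)) (auto simp del: times_divide_eq_left)
  finally show ?thesis
    using divergence_W[OF s] divergence_weighted_P[OF s] unfolding e2_def e3_def by simp
qed

lemma shifted_sq_0: "shifted_sq c 0 y powr (- n / 2) = 1 / R ^ DIM('a)" if "0 < R"
proof -
  have "shifted_sq c 0 y = R powr 2" using that by (simp add: shifted_sq_def power2_norm_eq_inner)
  then have "shifted_sq c 0 y powr (- n / 2) = R powr (- n)" by (simp only: powr_powr) simp
  then show ?thesis using that by (simp add: n_def powr_minus_divide powr_realpow)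
qed

lemma joint_continuity:
  assumes s: "\<bar>s\<bar> < R"
  shows "continuous_on (cball s ((R - \<bar>s\<bar>) / 2) \<times> B)
      (\<lambda>(s, y). 2 * (- n / 2) * P s y * (c \<bullet> y + s * (y \<bullet> y)))"
    and "continuous_on (cball s ((R - \<bar>s\<bar>) / 2) \<times> B)
      (\<lambda>(s, y). - 2 * s * (y \<bullet> y) * W s y
      - n * (R\<^sup>2 - s\<^sup>2 * (y \<bullet> y)) * P s y * (c \<bullet> y + s * (y \<bullet> y)))"
  unfolding split_beta
  by (intro continuous_intros continuous_on_powr_shifted_sq2[OF s])+

lemma near_s:
  assumes "\<bar>s\<bar> < R" "\<bar>t - s\<bar> \<le> (R - \<bar>s\<bar>) / 2"
  shows "\<bar>t\<bar> < R"
proof -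
  have "\<bar>t\<bar> \<le> \<bar>s\<bar> + \<bar>t - s\<bar>" by arith
  then show ?thesis using assms by (simp add: field_simps)
qed

lemma has_real_derivative_integral_W:
  assumes s: "\<bar>s\<bar> < R"
  shows "((\<lambda>s. LINT y:B|lebesgue. W s y) has_real_derivative
    - n * (LINT y:B|lebesgue. P s y * (c \<bullet> y + s * (y \<bullet> y)))) (at s)"
proof -
  have "((\<lambda>s. LINT y:B|lebesgue. (1::real) * W s y) has_real_derivative
    (LINT y:B|lebesgue. 1 * (2 * (- n / 2) * P s y * (c \<bullet> y + s * (y \<bullet> y))))) (at s)"
  proof (rule has_real_derivative_set_integral[where \<delta> = "(R - \<bar>s\<bar>) / 2"])
    fix t y assume t: "\<bar>t - s\<bar> \<le> (R - \<bar>s\<bar>) / 2" 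
    show "continuous_on B (W t)"
      by (rule continuous_on_powr_shifted_sq[OF near_s[OF s t]])
    assume y: "y \<in> B"
    show "((\<lambda>t. W t y) has_real_derivative 2 * (- n / 2) * P t y * (c \<bullet> y + t * (y \<bullet> y))) (at t)"
      by (rule has_real_derivative_shifted_sq_powr[OF near_s[OF s t] y])
  qed (use s joint_continuity[OF s] in auto)
  also have "(LINT y:B|lebesgue. 1 * (2 * (- n / 2) * P s y * (c \<bullet> y + s * (y \<bullet> y)))) =
      (LINT y:B|lebesgue. - n * (P s y * (c \<bullet> y + s * (y \<bullet> y))))"
    by (simp add: mult_ac)
  finally show ?thesis by (simp only: set_integral_mult_right mult_1)
qed

text \<open>
  The function \<open>(R\<^sup>2 - |z|\<^sup>2) / |c + z|\<^sup>n\<close> is a Poisson kernel, harmonic in \<open>|z| < R\<close>, and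
  this is its mean value property on balls.
\<close>

lemma integral_poisson_kernel:
  assumes s: "0 \<le> s" "s < R"
  shows "(LINT y:B|lebesgue. (R\<^sup>2 - s\<^sup>2 * (y \<bullet> y)) * W s y) = measure lebesgue B * (R\<^sup>2 / R ^ DIM('a))"
proof -
  let ?f = "\<lambda>s. LINT y:B|lebesgue. (R\<^sup>2 - s\<^sup>2 * (y \<bullet> y)) * W s y"
  have d: "(?f has_real_derivative (LINT y:B|lebesgue. - 2 * s * (y \<bullet> y) * W s y
      - n * (R\<^sup>2 - s\<^sup>2 * (y \<bullet> y)) * P s y * (c \<bullet> y + s * (y \<bullet> y)))) (at s)" if s: "\<bar>s\<bar> < R" for s
  proof -
    have "((\<lambda>s. LINT y:B|lebesgue. (1::real) * ((R\<^sup>2 - s\<^sup>2 * (y \<bullet> y)) * W s y)) has_real_derivative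
      (LINT y:B|lebesgue. 1 * (- 2 * s * (y \<bullet> y) * W s y
      - n * (R\<^sup>2 - s\<^sup>2 * (y \<bullet> y)) * P s y * (c \<bullet> y + s * (y \<bullet> y))))) (at s)"
    proof (rule has_real_derivative_set_integral[where \<delta> = "(R - \<bar>s\<bar>) / 2"])
      fix t y assume t: "\<bar>t - s\<bar> \<le> (R - \<bar>s\<bar>) / 2" 
      show "continuous_on B (\<lambda>y. (R\<^sup>2 - t\<^sup>2 * (y \<bullet> y)) * W t y)"
        by (intro continuous_intros continuous_on_powr_shifted_sq[OF near_s[OF s t]])
      assume y: "y \<in> B"
      show "((\<lambda>t. (R\<^sup>2 - t\<^sup>2 * (y \<bullet> y)) * W t y) has_real_derivative - 2 * t * (y \<bullet> y) * W t y
        - n * (R\<^sup>2 - t\<^sup>2 * (y \<bullet> y)) * P t y * (c \<bullet> y + t * (y \<bullet> y))) (at t)"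
        by (rule derivative_eq_intros refl has_real_derivative_shifted_sq_powr[OF near_s[OF s t] y])+
          (simp add: algebra_simps)
    qed (use s joint_continuity[OF s] in auto)
    then show ?thesis by simp
  qed
  have "?f s = ?f 0"
  proof (cases "s = 0")
    case False
    with s have s0: "0 < s" by simp
    \<comment> \<open>\<open>integral_radial_derivative\<close> carries the factor t, so it yields a
      zero derivative only for t > 0; continuity on {0..s} extends constancy to the endpoint
      0.\<close>
    show ?thesis
    proof (rule DERIV_isconst_end[OF s0])
      show "continuous_on {0..s} ?f"
        by (intro continuous_at_imp_continuous_on ballI, rule DERIV_isCont[OF d]) (use s in auto)
      fix t assume t: "0 < t" "t < s"
      then have "\<bar>t\<bar> < R" using s by simp
      from d[OF this] integral_radial_derivative[OF this] t
      show "(?f has_real_derivative 0) (at t)" by simp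
    qed
  qed simp
  also have "?f 0 = (LINT y:B|lebesgue. R\<^sup>2 / R ^ DIM('a))"
  proof -
    have "0 < R" using s by linarith
    then have "(\<lambda>y. (R\<^sup>2 - 0\<^sup>2 * (y \<bullet> y)) * W 0 y) = (\<lambda>y. R\<^sup>2 / R ^ DIM('a))"
      unfolding shifted_sq_0[OF \<open>0 < R\<close>] by simp
    then show ?thesis by (simp only:)
  qed
  also have "\<dots> = measure lebesgue B * (R\<^sup>2 / R ^ DIM('a))"
    unfolding set_lebesgue_integral_def by simp
  finally show ?thesis .
qed

text \<open>Since R^2 + s (c.y) = c.(c + s y), the integral is, up to the factor s^n, the component
  along c of the vector A of the ball. n (R^2 - s^2) times its integrand is n times the Poisson
  kernel plus two terms that integrate to 0, so the mean value property gives the value.\<close>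

lemma integral_radial_moment:
  assumes s: "0 \<le> s" "s < R"
  shows "(R\<^sup>2 - s\<^sup>2) * (LINT y:B|lebesgue. (R\<^sup>2 + s * (c \<bullet> y)) * P s y) =
    measure lebesgue B * (R\<^sup>2 / R ^ DIM('a))"
proof -
  have s': "\<bar>s\<bar> < R" using s by simp
  note i = integrand_continuous[OF s']
  have n0: "n \<noteq> 0" by (simp add: n_def)
  define e2 where "e2 = (\<lambda>y. (1 - y \<bullet> y) * (n * W s y - n * s * P s y * (c \<bullet> y + s * (y \<bullet> y)))
      - 2 * W s y * (y \<bullet> y))"
  define h where "h = (\<lambda>y. (R\<^sup>2 - s\<^sup>2 * (y \<bullet> y)) * W s y)"
  define dh where "dh = (\<lambda>y. - 2 * s * (y \<bullet> y) * W s y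
      - n * (R\<^sup>2 - s\<^sup>2 * (y \<bullet> y)) * P s y * (c \<bullet> y + s * (y \<bullet> y)))"
  have i2: "set_integrable lebesgue B e2" "set_integrable lebesgue B h" "set_integrable lebesgue B dh"
    unfolding e2_def h_def dh_def by (fact i)+
  have "n * (R\<^sup>2 - s\<^sup>2) * (LINT y:B|lebesgue. (R\<^sup>2 + s * (c \<bullet> y)) * P s y) =
      (LINT y:B|lebesgue. n * (R\<^sup>2 - s\<^sup>2) * ((R\<^sup>2 + s * (c \<bullet> y)) * P s y))"
    by (rule set_integral_mult_right[symmetric])
  also have "\<dots> = (LINT y:B|lebesgue. n * h y + (s * dh y - s\<^sup>2 * e2 y))"
  proof (rule set_lebesgue_integral_cong, simp, intro allI impI)
    fix y assume y: "y \<in> B"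
    define p where "p = P s y"
    show "n * (R\<^sup>2 - s\<^sup>2) * ((R\<^sup>2 + s * (c \<bullet> y)) * P s y) = n * h y + (s * dh y - s\<^sup>2 * e2 y)"
      unfolding e2_def h_def dh_def P_W[OF s' y] unfolding p_def[symmetric] unfolding shifted_sq_expand
      by (simp add: field_simps power2_eq_square)
  qed
  also have "\<dots> = n * (LINT y:B|lebesgue. h y)
      + (s * (LINT y:B|lebesgue. dh y) - s\<^sup>2 * (LINT y:B|lebesgue. e2 y))"
    using i2 by (simp add: set_integral_add(2) set_integral_diff(2) set_integral_diff(1) set_integrable_mult_right)
  also have "\<dots> = n * (LINT y:B|lebesgue. h y)"
    using divergence_W[OF s'] integral_radial_derivative[OF s'] unfolding e2_def dh_def by simp
  finally show ?thesis
    using integral_poisson_kernel[OF s] n0 unfolding h_def by simp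
qed

text \<open>The left side is the integral of |z|^(-n) over the ball. Its s-derivative is n s^(n-1)
  times the moment of \<open>integral_radial_moment\<close>, and this matches the derivative of
  G((s/R)^n) because G' at q^n is 1/(1 - q^2), where q = s/R. This is the computation that singles
  out the equation of the profile.\<close>

lemma integral_W:
  fixes G :: "real \<Rightarrow> real"
  assumes G0: "G 0 = 0"
    and G: "\<And>m. 0 \<le> m \<Longrightarrow> m < 1 \<Longrightarrow> (G has_real_derivative 1 / (1 - m powr (2 / n))) (at m)"
    and s: "0 \<le> s" "s < R"
  shows "s ^ DIM('a) * (LINT y:B|lebesgue. W s y) = measure lebesgue B * G ((s / R) ^ DIM('a))"
proof -
  let ?n = "DIM('a)"
  let ?w = "measure lebesgue B"
  have R: "0 < R" using s by linarith
  have n0: "?n > 0" by simp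
  let ?f = "\<lambda>s. s ^ ?n * (LINT y:B|lebesgue. W s y) - ?w * G ((s / R) ^ ?n)"
  have d: "(?f has_real_derivative 0) (at s)" if s: "0 \<le> s" "s < R" for s
  proof -
    have s': "\<bar>s\<bar> < R" using s by simp
    note i = integrand_continuous[OF s']
    define q where "q = s / R"
    have q: "0 \<le> q" "q < 1" using s R by (auto simp: q_def)
    have qn: "0 \<le> q ^ ?n" "q ^ ?n < 1"
      using q n0 power_strict_mono[of q 1 ?n] by auto
    have qp: "(q ^ ?n) powr (2 / n) = q\<^sup>2"
    proof (cases "q = 0")
      case False
      with q have "q > 0" by simp
      then have "(q ^ ?n) powr (2 / n) = (q powr n) powr (2 / n)" by (simp add: n_def powr_realpow)
      also have "\<dots> = q powr 2" by (simp add: powr_powr n_def)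
      finally show ?thesis using \<open>q > 0\<close> by simp
    qed (use n0 in simp)
    define V where "V = (LINT y:B|lebesgue. W s y)"
    define A where "A = (LINT y:B|lebesgue. (R\<^sup>2 + s * (c \<bullet> y)) * P s y)"
    define D where "D = (LINT y:B|lebesgue. P s y * (c \<bullet> y + s * (y \<bullet> y)))"
    \<comment> \<open>The product rule for s^n V produces V - s D. Pointwise |z|^2 - s (z.y) = z.c
      for z = c + s y, which identifies it with the moment A.\<close>
    have VA: "V - s * D = A"
    proof -
      have "V - s * D = (LINT y:B|lebesgue. W s y - s * (P s y * (c \<bullet> y + s * (y \<bullet> y))))"
        unfolding V_def D_def using i by (simp add: set_integral_diff(2) set_integrable_mult_right)
      also have "\<dots> = A"
        unfolding A_def
      proof (rule set_lebesgue_integral_cong, simp, intro allI impI)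
        fix y assume y: "y \<in> B"
        define p where "p = P s y"
        show "W s y - s * (P s y * (c \<bullet> y + s * (y \<bullet> y))) = (R\<^sup>2 + s * (c \<bullet> y)) * P s y"
          unfolding P_W[OF s' y] unfolding p_def[symmetric] unfolding shifted_sq_expand by (simp add: algebra_simps power2_eq_square)
      qed
      finally show ?thesis .
    qed
    have A: "(R\<^sup>2 - s\<^sup>2) * A = ?w * (R\<^sup>2 / R ^ ?n)"
      unfolding A_def by (rule integral_radial_moment[OF s])
    have "s\<^sup>2 < R\<^sup>2" using s by (intro power_strict_mono) auto
    then have A': "A = ?w * (R\<^sup>2 / R ^ ?n) / (R\<^sup>2 - s\<^sup>2)"
      using A by (intro eq_divide_imp) (simp_all add: mult.commute)
    have dG: "((\<lambda>s. G ((s / R) ^ ?n)) has_real_derivative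
        1 / (1 - q\<^sup>2) * (?n * (s / R) ^ (?n - 1) * (1 / R))) (at s)"
    proof (rule DERIV_chain2[where g = "\<lambda>s. (s / R) ^ ?n"])
      show "(G has_real_derivative 1 / (1 - q\<^sup>2)) (at ((s / R) ^ ?n))"
        using G[OF qn] qp by (simp add: q_def)
      show "((\<lambda>s. (s / R) ^ ?n) has_real_derivative ?n * (s / R) ^ (?n - 1) * (1 / R)) (at s)"
        by (rule derivative_eq_intros refl)+ (use R in auto)
    qed
    have pow: "((\<lambda>s. s ^ ?n) has_real_derivative ?n * s ^ (?n - 1)) (at s)"
      using DERIV_pow[of ?n s] by simp
    have "(?f has_real_derivative (?n * s ^ (?n - 1)) * V + (- n * D) * s ^ ?n
        - ?w * (1 / (1 - q\<^sup>2) * (?n * (s / R) ^ (?n - 1) * (1 / R)))) (at s)"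
      unfolding V_def D_def
      by (intro DERIV_diff[OF DERIV_mult[OF pow has_real_derivative_integral_W[OF s']] DERIV_cmult[OF dG]])
    moreover have "(?n * s ^ (?n - 1)) * V + (- n * D) * s ^ ?n
        - ?w * (1 / (1 - q\<^sup>2) * (?n * (s / R) ^ (?n - 1) * (1 / R))) = 0"
    proof -
      have sn: "s ^ ?n = s * s ^ (?n - 1)" and Rn: "R ^ ?n = R * R ^ (?n - 1)"
        using n0 by (simp_all add: power_eq_if)
      have "(?n * s ^ (?n - 1)) * V + (- n * D) * s ^ ?n = n * s ^ (?n - 1) * A"
        unfolding VA[symmetric] sn n_def by (simp add: algebra_simps)
      also have "\<dots> = ?w * (1 / (1 - q\<^sup>2) * (?n * (s / R) ^ (?n - 1) * (1 / R)))"
      proof -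
        have 1: "1 - q\<^sup>2 = (R\<^sup>2 - s\<^sup>2) / R\<^sup>2" using R by (simp add: q_def field_simps)
        show ?thesis unfolding A' 1 Rn n_def by (simp add: power_divide mult_ac)
      qed
      finally show ?thesis by simp
    qed
    ultimately show ?thesis by (rule DERIV_cong)
  qed
  have "?f s = ?f 0"
  proof (cases "s = 0")
    case False
    with s have s0: "0 < s" by simp
    show ?thesis
    proof (rule DERIV_isconst_end[OF s0])
      show "continuous_on {0..s} ?f"
        by (intro continuous_at_imp_continuous_on ballI, rule DERIV_isCont[OF d]) (use s in auto)
      show "(?f has_real_derivative 0) (at t)" if "0 < t" "t < s" for t
        by (rule d) (use that s in auto)
    qed
  qed simp
  also have "?f 0 = 0"
  proof -
    have "(0::real) ^ ?n = 0" "(0 / R) ^ ?n = 0" using n0 by (simp_all add: power_0_left)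
    then show ?thesis using G0 by (simp only: mult_zero_left mult_zero_right diff_self)
  qed
  finally show ?thesis by simp
qed

end

section \<open>The gradient estimate\<close>

definition sqdist :: "'a::euclidean_space \<Rightarrow> 'a \<Rightarrow> real" where
  "sqdist x z = (z - x) \<bullet> (z - x)"

lemma sqdist_pos: "x \<noteq> z \<Longrightarrow> 0 < sqdist x z"
  by (simp add: sqdist_def)

lemma continuous_on_sqdist [continuous_intros]:
  "continuous_on A f \<Longrightarrow> continuous_on A g \<Longrightarrow> continuous_on A (\<lambda>p. sqdist (f p) (g p))"
  unfolding sqdist_def by (intro continuous_intros)

lemma continuous_on_sqdist_powr:
  "x \<notin> K \<Longrightarrow> continuous_on K (\<lambda>z. sqdist x z powr a)"
  by (intro continuous_on_powr continuous_on_const continuous_on_sqdist continuous_on_id ballI)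
    (metis sqdist_pos less_irrefl)

text \<open>
  Among all densities with values in \<open>[0, 1]\<close>, the integral of a function \<open>h\<close> is smallest for
  the indicator of \<open>{h \<le> 0}\<close>.
\<close>

lemma set_integral_sign_le:
  fixes \<rho> h :: "'a \<Rightarrow> real"
  assumes "set_integrable M D h" "set_integrable M K (\<lambda>z. \<rho> z * h z)"
    and "\<And>z. 0 \<le> \<rho> z \<and> \<rho> z \<le> 1"
    and "\<And>z. z \<in> D \<Longrightarrow> h z \<le> 0" "\<And>z. z \<in> K \<Longrightarrow> z \<notin> D \<Longrightarrow> 0 \<le> h z"
  shows "(LINT z:D|M. h z) \<le> (LINT z:K|M. \<rho> z * h z)"
  unfolding set_lebesgue_integral_def
proof (rule integral_mono)
  fix z
  have "h z \<le> \<rho> z * h z" if "z \<in> D"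
    using mult_right_mono_neg[of "\<rho> z" 1 "h z"] assms(3)[of z] assms(4)[OF that] by simp
  then show "indicator D z *\<^sub>R h z \<le> indicator K z *\<^sub>R (\<rho> z * h z)"
    using assms(3)[of z] assms(4,5)[of z] by (auto simp: indicator_def)
qed (use assms in \<open>auto simp: set_integrable_def\<close>)

section \<open>Weighted kernel integrals and the comparison with a ball\<close>

locale weighted_compact =
  fixes K :: "'a::euclidean_space set" and \<rho> :: "'a \<Rightarrow> real"
  assumes K: "compact K"
    and \<rho>: "\<rho> \<in> borel_measurable lebesgue" "\<And>z. 0 \<le> \<rho> z \<and> \<rho> z \<le> 1"
begin

lemma \<rho>_abs: "\<bar>\<rho> z\<bar> \<le> 1" using \<rho>(2)[of z] by simp

lemma weighted_integrable: "continuous_on K g \<Longrightarrow> set_integrable lebesgue K (\<lambda>z. \<rho> z * g z)"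
  by (rule set_integrable_weighted[OF K _ \<rho>(1) \<rho>_abs])

text \<open>For a = -n/2 this is w times the potential, and for a = -n/2 - 1 it is the B of the
  overview. With powers of the squared distance, each differentiation in x lowers a by 1.\<close>

definition pot :: "real \<Rightarrow> 'a \<Rightarrow> real" where
  "pot a x = (LINT z:K|lebesgue. \<rho> z * sqdist x z powr a)"

text \<open>The first moment of \<rho> against |z - x|^(2a), assembled from its coordinates. Despite
  the name, the gradient of \<open>pot a\<close> is -2a times \<open>grad_pot (a - 1)\<close>; the
  index -n/2 - 1 gives the A of the overview.\<close>

definition grad_pot :: "real \<Rightarrow> 'a \<Rightarrow> 'a" where
  "grad_pot a x = (\<Sum>e\<in>Basis. (LINT z:K|lebesgue. \<rho> z * (sqdist x z powr a * ((z - x) \<bullet> e))) *\<^sub>R e)"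

lemma grad_pot_inner:
  assumes x: "x \<notin> K"
  shows "grad_pot a x \<bullet> v = (LINT z:K|lebesgue. \<rho> z * (sqdist x z powr a * ((z - x) \<bullet> v)))"
proof -
  let ?g = "\<lambda>e z. \<rho> z * (sqdist x z powr a * ((z - x) \<bullet> e))"
  have i: "set_integrable lebesgue K (?g e)" for e
    by (intro weighted_integrable continuous_on_mult continuous_on_sqdist_powr x continuous_on_inner continuous_intros)
  have "grad_pot a x \<bullet> v = (\<Sum>e\<in>Basis. (e \<bullet> v) * (LINT z:K|lebesgue. ?g e z))"
    unfolding grad_pot_def inner_sum_left by (simp add: mult.commute)
  also have "\<dots> = (\<Sum>e\<in>Basis. LINT z|lebesgue. (e \<bullet> v) * (indicator K z *\<^sub>R ?g e z))"
    unfolding set_lebesgue_integral_def by simp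
  also have "\<dots> = (LINT z|lebesgue. (\<Sum>e\<in>Basis. (e \<bullet> v) * (indicator K z *\<^sub>R ?g e z)))"
    by (rule Bochner_Integration.integral_sum[symmetric])
      (use i in \<open>simp add: set_integrable_def\<close>)
  also have "\<dots> = (LINT z:K|lebesgue. ?g v z)"
    unfolding set_lebesgue_integral_def
  proof (rule Bochner_Integration.integral_cong)
    fix z
    have "(z - x) \<bullet> v = (\<Sum>e\<in>Basis. ((z - x) \<bullet> e) * (v \<bullet> e))"
      by (rule euclidean_inner)
    then show "(\<Sum>e\<in>Basis. (e \<bullet> v) * (indicator K z *\<^sub>R ?g e z)) = indicator K z *\<^sub>R ?g v z"
      by (simp add: sum_distrib_left mult_ac inner_commute)
  qed simp
  finally show ?thesis .
qed

text \<open>Take h(z) = (|z - x - c|^2 - s^2) / |z - x|^(n+2), which off x is nonpositive exactly on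
  the ball D around x + c. The right side is the integral of \<rho> h with the square expanded; the
  left side is the integral of h over D, evaluated by the formulas for balls.\<close>

lemma bathtub:
  fixes c x :: 'a
  assumes x: "x \<notin> K" and s: "0 < s" "s < norm c"
    and G0: "G 0 = 0"
    and G: "\<And>m. 0 \<le> m \<Longrightarrow> m < 1 \<Longrightarrow> (G has_real_derivative 1 / (1 - m powr (2 / DIM('a)))) (at m)"
  shows "measure lebesgue (cball (0::'a) 1) *
      (G ((s / norm c) ^ DIM('a)) - (s / norm c) ^ DIM('a) * (norm c)\<^sup>2 / ((norm c)\<^sup>2 - s\<^sup>2))
    \<le> pot (- real DIM('a) / 2) x - 2 * (grad_pot (- real DIM('a) / 2 - 1) x \<bullet> c)
      + ((norm c)\<^sup>2 - s\<^sup>2) * pot (- real DIM('a) / 2 - 1) x"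
proof -
  interpret ball_integrals c "DIM('a)" by standard simp
  define n where "n = real DIM('a)"
  let ?w = "measure lebesgue (cball (0::'a) 1)"
  let ?q = "\<lambda>z. sqdist x z"
  have s': "\<bar>s\<bar> < R" "0 \<le> s" using s by auto
  have R: "0 < R" using s by linarith
  define D where "D = cball (x + c) s"
  have xD: "x \<notin> D" using s by (simp add: D_def dist_norm)
  define h where "h z = (?q z - 2 * ((z - x) \<bullet> c) + (R\<^sup>2 - s\<^sup>2)) * ?q z powr (- n / 2 - 1)" for z
  have hc: "continuous_on A h" if "x \<notin> A" for A
    unfolding h_def using that
    by (intro continuous_on_mult continuous_on_sqdist_powr continuous_intros)
  have sq: "?q z - 2 * ((z - x) \<bullet> c) + R\<^sup>2 = (norm (z - (x + c)))\<^sup>2" for z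
    by (simp add: sqdist_def power2_norm_eq_inner algebra_simps inner_commute)
  have sgn: "h z \<le> 0 \<longleftrightarrow> z \<in> D" "0 \<le> h z \<longleftrightarrow> s \<le> norm (z - (x + c))" if "z \<noteq> x" for z
  proof -
    have pos: "0 < ?q z powr (- n / 2 - 1)" using sqdist_pos[of x z] that by simp
    have "h z = ((norm (z - (x + c)))\<^sup>2 - s\<^sup>2) * ?q z powr (- n / 2 - 1)"
      using sq[of z] by (simp add: h_def)
    then have "h z \<le> 0 \<longleftrightarrow> (norm (z - (x + c)))\<^sup>2 \<le> s\<^sup>2" "0 \<le> h z \<longleftrightarrow> s\<^sup>2 \<le> (norm (z - (x + c)))\<^sup>2"
      using pos by (auto simp: mult_le_0_iff zero_le_mult_iff)
    then show "h z \<le> 0 \<longleftrightarrow> z \<in> D" "0 \<le> h z \<longleftrightarrow> s \<le> norm (z - (x + c))"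
      using s' by (auto simp: D_def dist_norm norm_minus_commute power_mono_iff abs_le_square_iff[symmetric])
  qed
  have lo: "(LINT z:D|lebesgue. h z) \<le> (LINT z:K|lebesgue. \<rho> z * h z)"
  proof (rule set_integral_sign_le)
    show "set_integrable lebesgue D h"
      by (rule set_integrable_continuous_compact[OF _ hc[OF xD]]) (simp add: D_def)
    show "set_integrable lebesgue K (\<lambda>z. \<rho> z * h z)"
      by (rule weighted_integrable[OF hc[OF x]])
    show "h z \<le> 0" if "z \<in> D" for z using sgn(1)[of z] xD that by metis
    show "0 \<le> h z" if "z \<in> K" "z \<notin> D" for z
      using sgn(2)[of z] x that by (auto simp: D_def dist_norm norm_minus_commute)
  qed (rule \<rho>)
  have "(LINT z:K|lebesgue. \<rho> z * h z) =
      (LINT z:K|lebesgue. (\<rho> z * ?q z powr (- n / 2) - 2 * (\<rho> z * (?q z powr (- n / 2 - 1) * ((z - x) \<bullet> c))))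
        + (R\<^sup>2 - s\<^sup>2) * (\<rho> z * ?q z powr (- n / 2 - 1)))"
  proof (rule set_lebesgue_integral_cong[OF fmeasurableD[OF lmeasurable_compact[OF K]]], intro allI impI)
    fix z assume "z \<in> K"
    then have "0 < ?q z" using x sqdist_pos[of x z] by metis
    then have W: "?q z powr (- n / 2) = ?q z * ?q z powr (- n / 2 - 1)"
      by (simp add: powr_diff)
    define p where "p = ?q z powr (- n / 2 - 1)"
    show "\<rho> z * h z = (\<rho> z * ?q z powr (- n / 2) - 2 * (\<rho> z * (?q z powr (- n / 2 - 1) * ((z - x) \<bullet> c))))
        + (R\<^sup>2 - s\<^sup>2) * (\<rho> z * ?q z powr (- n / 2 - 1))"
      unfolding W h_def p_def[symmetric] by (simp add: algebra_simps)
  qed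
  also have "\<dots> = pot (- n / 2) x - 2 * (grad_pot (- n / 2 - 1) x \<bullet> c) + (R\<^sup>2 - s\<^sup>2) * pot (- n / 2 - 1) x"
  proof -
    have i: "set_integrable lebesgue K (\<lambda>z. \<rho> z * ?q z powr (- n / 2))"
      "set_integrable lebesgue K (\<lambda>z. \<rho> z * ?q z powr (- n / 2 - 1))"
      "set_integrable lebesgue K (\<lambda>z. \<rho> z * (?q z powr (- n / 2 - 1) * ((z - x) \<bullet> c)))"
      by (intro weighted_integrable continuous_on_mult continuous_on_sqdist_powr x continuous_on_inner continuous_intros)+
    show ?thesis
      unfolding pot_def grad_pot_inner[OF x] using i
      by (simp only: set_integral_add set_integral_diff set_integrable_mult_right set_integral_mult_right)
  qed
  finally have up: "(LINT z:K|lebesgue. \<rho> z * h z) = \<dots>" .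
  have "(LINT z:D|lebesgue. h z) = s ^ DIM('a) * (LINT y:B|lebesgue. h (x + c + s *\<^sub>R y))"
    unfolding D_def by (rule set_integral_cball_affine[OF s(1)]) (use hc[OF xD] in \<open>simp add: D_def\<close>)
  also have "(LINT y:B|lebesgue. h (x + c + s *\<^sub>R y)) = (LINT y:B|lebesgue. - (s\<^sup>2) * ((1 - y \<bullet> y) * P s y))"
  proof (rule set_lebesgue_integral_cong, simp, intro allI impI)
    fix y assume "y \<in> B"
    have q: "?q (x + c + s *\<^sub>R y) = shifted_sq c s y" by (simp add: sqdist_def shifted_sq_def)
    \<comment> \<open>In the coordinate y the numerator of h is |s y|^2 - s^2.\<close>
    have "shifted_sq c s y - 2 * ((c + s *\<^sub>R y) \<bullet> c) + (R\<^sup>2 - s\<^sup>2) = - (s\<^sup>2) * (1 - y \<bullet> y)"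
      by (simp add: shifted_sq_expand algebra_simps inner_commute power2_norm_eq_inner)
    then show "h (x + c + s *\<^sub>R y) = - (s\<^sup>2) * ((1 - y \<bullet> y) * P s y)"
      unfolding h_def q n_def by simp
  qed
  also have "\<dots> = - (s\<^sup>2 * (LINT y:B|lebesgue. (1 - y \<bullet> y) * P s y))"
    by (simp only: set_integral_mult_right)
  also have "\<dots> = (LINT y:B|lebesgue. W s y) - (LINT y:B|lebesgue. (R\<^sup>2 + s * (c \<bullet> y)) * P s y)"
    unfolding integral_defect[OF s'(1)] by simp
  finally have D1: "(LINT z:D|lebesgue. h z) = s ^ DIM('a) * (LINT y:B|lebesgue. W s y)
      - s ^ DIM('a) * (LINT y:B|lebesgue. (R\<^sup>2 + s * (c \<bullet> y)) * P s y)"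
    by (simp only: right_diff_distrib)
  have "s\<^sup>2 < R\<^sup>2" using s by (intro power_strict_mono) auto
  then have at: "(LINT y:B|lebesgue. (R\<^sup>2 + s * (c \<bullet> y)) * P s y) = ?w * (R\<^sup>2 / R ^ DIM('a)) / (R\<^sup>2 - s\<^sup>2)"
    by (subst integral_radial_moment[OF s'(2) s(2), symmetric]) simp
  have iw: "s ^ DIM('a) * (LINT y:B|lebesgue. W s y) = ?w * G ((s / R) ^ DIM('a))"
    by (rule integral_W[OF G0 G s'(2) s(2)])
  have "(LINT z:D|lebesgue. h z) = ?w * (G ((s / R) ^ DIM('a)) - (s / R) ^ DIM('a) * R\<^sup>2 / (R\<^sup>2 - s\<^sup>2))"
    unfolding D1 at using iw by (simp add: right_diff_distrib power_divide)
  then show ?thesis using lo up unfolding n_def by simp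
qed

lemma pot_nonneg: "0 \<le> pot a x"
  unfolding pot_def set_lebesgue_integral_def
  by (rule integral_nonneg_AE) (use \<rho>(2) in \<open>auto intro!: AE_I2 simp: indicator_def\<close>)

text \<open>On the compact set K the squared distance to x is bounded by some C, so
  \<open>pot a x\<close> is at most C times \<open>pot (a - 1) x\<close>. In
  \<open>gradient_estimate\<close> this makes b a legitimate divisor.\<close>

lemma pot_pos_mono:
  assumes x: "x \<notin> K" and V: "0 < pot a x"
  shows "0 < pot (a - 1) x"
proof -
  have "compact (sqdist x ` K)" by (intro compact_continuous_image K continuous_intros)
  then obtain C where C: "\<And>z. z \<in> K \<Longrightarrow> sqdist x z \<le> C"
    using compact_imp_bounded[of "sqdist x ` K"] bounded_real[of "sqdist x ` K"]
    by (metis abs_le_D1 imageI)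
  have i: "set_integrable lebesgue K (\<lambda>z. \<rho> z * sqdist x z powr a)" for a
    by (intro weighted_integrable continuous_on_sqdist_powr x)
  have "pot a x \<le> (LINT z:K|lebesgue. C * (\<rho> z * sqdist x z powr (a - 1)))"
    unfolding pot_def
  proof (rule set_integral_mono[OF i set_integrable_mult_right[OF i]])
    fix z assume z: "z \<in> K"
    then have q: "0 < sqdist x z" using x sqdist_pos[of x z] by metis
    then have W: "sqdist x z powr a = sqdist x z * sqdist x z powr (a - 1)"
      by (simp add: powr_diff)
    have "sqdist x z * (\<rho> z * sqdist x z powr (a - 1)) \<le> C * (\<rho> z * sqdist x z powr (a - 1))"
      using C[OF z] \<rho>(2)[of z] by (intro mult_right_mono) auto
    then show "\<rho> z * sqdist x z powr a \<le> C * (\<rho> z * sqdist x z powr (a - 1))"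
      unfolding W by (simp add: mult_ac)
  qed
  then have "pot a x \<le> C * pot (a - 1) x" by (simp add: pot_def)
  then show ?thesis using V pot_nonneg[of "a - 1" x] by (cases "pot (a - 1) x = 0") auto
qed

lemma gradient_estimate:
  assumes x: "x \<notin> K" and n: "DIM('a) \<ge> 2"
    and w: "w = measure lebesgue (cball (0::'a) 1)"
    and V: "0 < pot (- real DIM('a) / 2) x"
  shows "(norm (grad_pot (- real DIM('a) / 2 - 1) x))\<^sup>2
      \<le> w * profile DIM('a) (pot (- real DIM('a) / 2) x / w) * pot (- real DIM('a) / 2 - 1) x"
proof -
  obtain G where G: "G 0 = 0"
     "\<And>m. 0 \<le> m \<Longrightarrow> m < 1 \<Longrightarrow> (G has_real_derivative 1 / (1 - m powr (2 / DIM('a)))) (at m)"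
    and prof: "\<And>t. 0 \<le> t \<Longrightarrow> 0 \<le> profile DIM('a) t \<and> profile DIM('a) t < 1 \<and> G (profile DIM('a) t) = t"
     "\<And>t. 0 < t \<Longrightarrow> 0 < profile DIM('a) t"
    using profile_inverse[OF n] by metis
  have w0: "0 < w" unfolding w using content_cball_pos[of 1 "0::'a"] by simp
  define A where "A = grad_pot (- real DIM('a) / 2 - 1) x"
  define b where "b = pot (- real DIM('a) / 2 - 1) x"
  define v where "v = pot (- real DIM('a) / 2) x / w"
  define m where "m = profile DIM('a) v"
  have b0: "0 < b" unfolding b_def by (rule pot_pos_mono[OF x V])
  have v0: "0 < v" using V w0 by (simp add: v_def)
  have m: "0 < m" "m < 1" "G m = v" using prof(1)[of v] prof(2)[of v] v0 by (auto simp: m_def)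
  have "(norm A)\<^sup>2 \<le> w * m * b"
  \<comment> \<open>For A = 0 the centre c below would be 0, which \<open>bathtub\<close>
    excludes.\<close>
  proof (cases "A = 0")
    case True
    then show ?thesis using w0 m b0 by simp
  next
    case False
    \<comment> \<open>Balls with s/|c| = \<sigma> have potential G(\<sigma>^n) = G(m) = v, so v
      cancels from the two sides of \<open>bathtub\<close>.\<close>
    define \<sigma> where "\<sigma> = root DIM('a) m"
    have \<sigma>: "0 < \<sigma>" "\<sigma> < 1" "\<sigma> ^ DIM('a) = m"
      using m by (auto simp: \<sigma>_def)
    define k where "k = 1 - \<sigma>\<^sup>2"
    have k: "0 < k" using \<sigma> power_strict_mono[of \<sigma> 1 2] by (simp add: k_def)
    \<comment> \<open>For c = \<kappa> A the terms of the upper bound that depend on \<kappa> are -2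
      \<kappa> |A|^2 + \<kappa>^2 |A|^2 k b. This \<kappa> minimises them, with minimum -|A|^2 / (k
      b).\<close>
    define \<kappa> where "\<kappa> = 1 / (k * b)"
    have \<kappa>: "0 < \<kappa>" using k b0 by (simp add: \<kappa>_def)
    define c where "c = \<kappa> *\<^sub>R A"
    have c: "0 < norm c" using \<kappa> False by (simp add: c_def)
    define s where "s = \<sigma> * norm c"
    have s: "0 < s" "s < norm c" using \<sigma> c by (auto simp: s_def)
    have "w * (G ((s / norm c) ^ DIM('a)) - (s / norm c) ^ DIM('a) * (norm c)\<^sup>2 / ((norm c)\<^sup>2 - s\<^sup>2))
      \<le> pot (- real DIM('a) / 2) x - 2 * (A \<bullet> c) + ((norm c)\<^sup>2 - s\<^sup>2) * b"
      unfolding w A_def b_def by (rule bathtub[OF x s G])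
    moreover have "s / norm c = \<sigma>" using c by (simp add: s_def)
    moreover have "(norm c)\<^sup>2 - s\<^sup>2 = (norm c)\<^sup>2 * k" by (simp add: s_def k_def power_mult_distrib algebra_simps)
    moreover have "pot (- real DIM('a) / 2) x = w * v" using w0 by (simp add: v_def)
    ultimately have "w * (v - m * (norm c)\<^sup>2 / ((norm c)\<^sup>2 * k)) \<le> w * v - 2 * (A \<bullet> c) + (norm c)\<^sup>2 * k * b"
      using \<sigma> m by simp
    moreover have "m * (norm c)\<^sup>2 / ((norm c)\<^sup>2 * k) = m / k" using c by simp
    moreover have "A \<bullet> c = \<kappa> * (norm A)\<^sup>2" by (simp add: c_def power2_norm_eq_inner)
    moreover have "(norm c)\<^sup>2 * k * b = \<kappa> * (norm A)\<^sup>2"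
    proof -
      have "(norm c)\<^sup>2 = \<kappa>\<^sup>2 * (norm A)\<^sup>2" using \<kappa> by (simp add: c_def power_mult_distrib)
      then have "(norm c)\<^sup>2 * k * b = \<kappa> * (norm A)\<^sup>2 * (\<kappa> * (k * b))" by (simp add: power2_eq_square)
      also have "\<kappa> * (k * b) = 1" using k b0 by (simp add: \<kappa>_def)
      finally show ?thesis by simp
    qed
    ultimately have "\<kappa> * (norm A)\<^sup>2 \<le> w * m / k" by (simp add: right_diff_distrib)
    then have "(norm A)\<^sup>2 / (k * b) \<le> w * m / k" by (simp add: \<kappa>_def)
    then show ?thesis using k b0 by (simp add: field_simps)
  qed
  then show ?thesis by (simp add: A_def b_def m_def v_def mult_ac)
qed

end

section \<open>Derivatives of the potential\<close>

lemma sqdist_powr_has_real_derivative: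
  assumes "x + t *\<^sub>R e \<noteq> z"
  shows "((\<lambda>t. sqdist (x + t *\<^sub>R e) z powr a) has_real_derivative
    - 2 * a * (sqdist (x + t *\<^sub>R e) z powr (a - 1) * ((z - (x + t *\<^sub>R e)) \<bullet> e))) (at t)"
proof -
  have d: "((\<lambda>t. sqdist (x + t *\<^sub>R e) z) has_real_derivative - 2 * ((z - (x + t *\<^sub>R e)) \<bullet> e)) (at t)"
  proof -
    have "(\<lambda>t. sqdist (x + t *\<^sub>R e) z) = (\<lambda>t. sqdist x z - 2 * t * ((z - x) \<bullet> e) + t\<^sup>2 * (e \<bullet> e))"
      by (simp add: sqdist_def fun_eq_iff algebra_simps inner_commute power2_eq_square)
    moreover have "((\<lambda>t. sqdist x z - 2 * t * ((z - x) \<bullet> e) + t\<^sup>2 * (e \<bullet> e)) has_real_derivative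
        - 2 * ((z - (x + t *\<^sub>R e)) \<bullet> e)) (at t)"
      by (rule derivative_eq_intros refl)+ (simp add: algebra_simps)
    ultimately show ?thesis by simp
  qed
  have pos: "0 < sqdist (x + t *\<^sub>R e) z" by (rule sqdist_pos[OF assms])
  show ?thesis
    using DERIV_powr[OF d pos DERIV_const[of a]] pos
    by (auto simp: powr_diff algebra_simps elim!: DERIV_cong)
qed

text \<open>Supplies the compact parameter interval on which the kernels along a line are
  nonsingular, as differentiation under the integral requires.\<close>

lemma line_avoids_closed:
  fixes x e :: "'a::euclidean_space"
  assumes "closed K" "x \<notin> K" "norm e = 1"
  obtains \<delta> where "\<delta> > 0" "\<And>t. \<bar>t\<bar> \<le> \<delta> \<Longrightarrow> x + t *\<^sub>R e \<notin> K"
proof -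
  obtain r where r: "r > 0" "cball x r \<subseteq> - K"
    using assms open_contains_cball[of "- K"] by (auto simp: open_Compl)
  show thesis
  proof (rule that[OF r(1)])
    fix t :: real assume "\<bar>t\<bar> \<le> r"
    then have "x + t *\<^sub>R e \<in> cball x r" using assms(3) by (simp add: dist_norm)
    then show "x + t *\<^sub>R e \<notin> K" using r by blast
  qed
qed

context weighted_compact
begin

lemma closed_K: "closed K" using K by (rule compact_imp_closed)

lemma continuous_on_line_powr:
  assumes "\<And>t. \<bar>t\<bar> \<le> \<delta> \<Longrightarrow> x + t *\<^sub>R e \<notin> K"
  shows "continuous_on (cball (0::real) \<delta> \<times> K) (\<lambda>p. sqdist (x + fst p *\<^sub>R e) (snd p) powr a)"
proof (rule continuous_on_powr)
  show "\<forall>p\<in>cball (0::real) \<delta> \<times> K. sqdist (x + fst p *\<^sub>R e) (snd p) \<noteq> 0"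
  proof
    fix p assume p: "p \<in> cball (0::real) \<delta> \<times> K"
    then have "x + fst p *\<^sub>R e \<notin> K" "snd p \<in> K" using assms[of "fst p"] by auto
    then have "x + fst p *\<^sub>R e \<noteq> snd p" by metis
    from sqdist_pos[OF this] show "sqdist (x + fst p *\<^sub>R e) (snd p) \<noteq> 0" by simp
  qed
qed (intro continuous_intros)+

lemma pot_has_real_derivative:
  assumes x: "x \<notin> K" and e: "norm e = 1"
  shows "((\<lambda>t. pot a (x + t *\<^sub>R e)) has_real_derivative - 2 * a * (grad_pot (a - 1) x \<bullet> e)) (at 0)"
proof -
  obtain \<delta> where \<delta>: "\<delta> > 0" "\<And>t. \<bar>t\<bar> \<le> \<delta> \<Longrightarrow> x + t *\<^sub>R e \<notin> K"
    using line_avoids_closed[OF closed_K x e] by blast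
  have "((\<lambda>t. LINT z:K|lebesgue. \<rho> z * sqdist (x + t *\<^sub>R e) z powr a) has_real_derivative
      (LINT z:K|lebesgue. \<rho> z * (- 2 * a * (sqdist (x + 0 *\<^sub>R e) z powr (a - 1) * ((z - (x + 0 *\<^sub>R e)) \<bullet> e))))) (at 0)"
  proof (rule has_real_derivative_set_integral[OF K \<delta>(1) \<rho>(1) \<rho>_abs])
    fix t :: real assume t: "\<bar>t - 0\<bar> \<le> \<delta>"
    then have xt: "x + t *\<^sub>R e \<notin> K" using \<delta>(2) by simp
    show "continuous_on K (\<lambda>z. sqdist (x + t *\<^sub>R e) z powr a)"
      by (rule continuous_on_sqdist_powr[OF xt])
    fix z assume "z \<in> K"
    then show "((\<lambda>t. sqdist (x + t *\<^sub>R e) z powr a) has_real_derivative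
       - 2 * a * (sqdist (x + t *\<^sub>R e) z powr (a - 1) * ((z - (x + t *\<^sub>R e)) \<bullet> e))) (at t)"
      by (intro sqdist_powr_has_real_derivative) (use xt in metis)
  next
    show "continuous_on (cball 0 \<delta> \<times> K) (\<lambda>(t, z). - 2 * a * (sqdist (x + t *\<^sub>R e) z powr (a - 1) * ((z - (x + t *\<^sub>R e)) \<bullet> e)))"
      unfolding split_beta
      by (intro continuous_on_mult continuous_on_line_powr[OF \<delta>(2)] continuous_intros) auto
  qed
  also have "(LINT z:K|lebesgue. \<rho> z * (- 2 * a * (sqdist (x + 0 *\<^sub>R e) z powr (a - 1) * ((z - (x + 0 *\<^sub>R e)) \<bullet> e)))) =
     (LINT z:K|lebesgue. (- 2 * a) * (\<rho> z * (sqdist x z powr (a - 1) * ((z - x) \<bullet> e))))"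
    by (simp add: mult_ac)
  also have "\<dots> = - 2 * a * (grad_pot (a - 1) x \<bullet> e)"
    unfolding grad_pot_inner[OF x] by (rule set_integral_mult_right)
  finally show ?thesis by (simp only: pot_def)
qed

text \<open>The second moment of \<rho> in direction e. It is one part of a second derivative of the
  potential; the other comes from differentiating the factor z - x in
  \<open>grad_pot\<close>.\<close>

definition hess_pot :: "real \<Rightarrow> 'a \<Rightarrow> 'a \<Rightarrow> real" where
  "hess_pot a e x = (LINT z:K|lebesgue. \<rho> z * (sqdist x z powr a * ((z - x) \<bullet> e)\<^sup>2))"

lemma grad_pot_has_real_derivative:
  assumes x: "x \<notin> K" and e: "norm e = 1"
  shows "((\<lambda>t. grad_pot a (x + t *\<^sub>R e) \<bullet> e) has_real_derivative
    - 2 * a * hess_pot (a - 1) e x - pot a x) (at 0)"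
proof -
  have ee: "e \<bullet> e = 1" using e by (simp add: norm_eq_1)
  obtain \<delta> where \<delta>: "\<delta> > 0" "\<And>t. \<bar>t\<bar> \<le> \<delta> \<Longrightarrow> x + t *\<^sub>R e \<notin> K"
    using line_avoids_closed[OF closed_K x e] by blast
  define k where "k t z = sqdist (x + t *\<^sub>R e) z powr a * ((z - (x + t *\<^sub>R e)) \<bullet> e)" for t z
  define k' where "k' t z = - 2 * a * (sqdist (x + t *\<^sub>R e) z powr (a - 1) * ((z - (x + t *\<^sub>R e)) \<bullet> e)\<^sup>2)
     - sqdist (x + t *\<^sub>R e) z powr a" for t z
  have d: "((\<lambda>t. LINT z:K|lebesgue. \<rho> z * k t z) has_real_derivative
      (LINT z:K|lebesgue. \<rho> z * k' 0 z)) (at 0)"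
  proof (rule has_real_derivative_set_integral[OF K \<delta>(1) \<rho>(1) \<rho>_abs])
    fix t :: real assume t: "\<bar>t - 0\<bar> \<le> \<delta>"
    then have xt: "x + t *\<^sub>R e \<notin> K" using \<delta>(2) by simp
    show "continuous_on K (k t)"
      unfolding k_def by (intro continuous_on_mult continuous_on_sqdist_powr[OF xt] continuous_intros)
    fix z assume z: "z \<in> K"
    have "x + t *\<^sub>R e \<noteq> z" using xt z by metis
    note 1 = sqdist_powr_has_real_derivative[OF this, of a]
    have 2: "((\<lambda>t. (z - (x + t *\<^sub>R e)) \<bullet> e) has_real_derivative - 1) (at t)"
    proof -
      have "(\<lambda>t. (z - (x + t *\<^sub>R e)) \<bullet> e) = (\<lambda>t. (z - x) \<bullet> e - t)"
        by (simp add: fun_eq_iff inner_diff_left inner_add_left ee)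
      moreover have "((\<lambda>t. (z - x) \<bullet> e - t) has_real_derivative - 1) (at t)"
        by (auto intro!: derivative_eq_intros)
      ultimately show ?thesis by simp
    qed
    show "((\<lambda>t. k t z) has_real_derivative k' t z) (at t)"
      unfolding k_def k'_def
      by (rule DERIV_cong[OF DERIV_mult[OF 1 2]]) (simp add: power2_eq_square)
  next
    show "continuous_on (cball 0 \<delta> \<times> K) (\<lambda>(t, z). k' t z)"
      unfolding split_beta k'_def
      by (intro continuous_on_mult continuous_on_diff continuous_on_line_powr[OF \<delta>(2)] continuous_intros) auto
  qed
  have i: "set_integrable lebesgue K (\<lambda>z. \<rho> z * (sqdist x z powr (a - 1) * ((z - x) \<bullet> e)\<^sup>2))"
     "set_integrable lebesgue K (\<lambda>z. \<rho> z * sqdist x z powr a)"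
    by (intro weighted_integrable continuous_on_mult continuous_on_sqdist_powr x continuous_intros)+
  have "(LINT z:K|lebesgue. \<rho> z * k' 0 z) =
     (LINT z:K|lebesgue. (- 2 * a) * (\<rho> z * (sqdist x z powr (a - 1) * ((z - x) \<bullet> e)\<^sup>2)) - \<rho> z * sqdist x z powr a)"
    by (simp add: k'_def algebra_simps)
  also have "\<dots> = - 2 * a * hess_pot (a - 1) e x - pot a x"
    unfolding hess_pot_def pot_def using i
    by (simp only: set_integral_diff set_integrable_mult_right set_integral_mult_right)
  finally have "((\<lambda>t. LINT z:K|lebesgue. \<rho> z * k t z) has_real_derivative
      - 2 * a * hess_pot (a - 1) e x - pot a x) (at 0)" using d by (simp only:)
  \<comment> \<open>\<open>grad_pot_inner\<close> identifies the coordinatewise vector with the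
    scalar integral only off K, so the two functions of t are compared within the distance
    \<delta>.\<close>
  then show ?thesis
  proof (rule has_field_derivative_transform_within[OF _ \<delta>(1)])
    fix t :: real assume "dist t 0 < \<delta>"
    then have "x + t *\<^sub>R e \<notin> K" using \<delta>(2) by simp
    from grad_pot_inner[OF this] show "(LINT z:K|lebesgue. \<rho> z * k t z) = grad_pot a (x + t *\<^sub>R e) \<bullet> e"
      by (simp add: k_def)
  qed simp
qed

text \<open>The squares of the coordinates of z - x add up to |z - x|^2, which raises the exponent
  by 1. This evaluates the trace in the Laplacian of the potential.\<close>

lemma sum_hess_pot:
  assumes x: "x \<notin> K"
  shows "(\<Sum>e\<in>Basis. hess_pot (a - 1) e x) = pot a x"
proof -
  let ?g = "\<lambda>e z. \<rho> z * (sqdist x z powr (a - 1) * ((z - x) \<bullet> e)\<^sup>2)"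
  have i: "set_integrable lebesgue K (?g e)" for e
    by (intro weighted_integrable continuous_on_mult continuous_on_sqdist_powr x continuous_intros)
  have "(\<Sum>e\<in>Basis. hess_pot (a - 1) e x) = (LINT z|lebesgue. (\<Sum>e\<in>Basis. indicator K z *\<^sub>R ?g e z))"
    unfolding hess_pot_def set_lebesgue_integral_def
    by (rule Bochner_Integration.integral_sum[symmetric]) (use i in \<open>simp add: set_integrable_def\<close>)
  also have "\<dots> = pot a x"
    unfolding pot_def set_lebesgue_integral_def
  proof (rule Bochner_Integration.integral_cong)
    fix z
    show "(\<Sum>e\<in>Basis. indicator K z *\<^sub>R ?g e z) = indicator K z *\<^sub>R (\<rho> z * sqdist x z powr a)"
    proof (cases "z \<in> K")
      case True
      then have "x \<noteq> z" using x by metis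
      then have "0 < sqdist x z" by (rule sqdist_pos)
      then have "sqdist x z powr a = sqdist x z powr (a - 1) * sqdist x z" by (simp add: powr_diff)
      moreover have "sqdist x z = (\<Sum>e\<in>Basis. ((z - x) \<bullet> e)\<^sup>2)"
        unfolding sqdist_def by (subst euclidean_inner) (simp add: power2_eq_square)
      ultimately show ?thesis using True by (simp add: sum_distrib_left)
    qed simp
  qed simp
  finally show ?thesis .
qed

lemma continuous_on_pot: "continuous_on (- K) (pot a)"
proof (intro continuous_at_imp_continuous_on ballI)
  fix x assume "x \<in> - K"
  then obtain r where r: "r > 0" "cball x r \<subseteq> - K"
    using open_contains_cball[of "- K"] closed_K by (auto simp: open_Compl)
  have "continuous_on (cball x r) (pot a)"
    unfolding pot_def
  proof (rule continuous_on_set_integral[OF K _ \<rho>(1) \<rho>_abs])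
    show "continuous_on (cball x r \<times> K) (\<lambda>(x, z). sqdist x z powr a)"
      unfolding split_beta
    proof (intro continuous_on_powr continuous_on_sqdist continuous_intros ballI)
      fix p assume "p \<in> cball x r \<times> K"
      then have "fst p \<noteq> snd p" using r by (auto simp: mem_Times_iff)
      from sqdist_pos[OF this] show "sqdist (fst p) (snd p) \<noteq> 0" by simp
    qed
  qed simp
  then show "isCont (pot a) x"
    using r(1) by (intro continuous_on_interior[of "cball x r"]) auto
qed

end

section \<open>The maximum principle\<close>

text \<open>If c were positive, \<phi>' would vanish at 0 and be positive just to the right, so
  \<phi> would exceed its maximum. Differentiability of \<phi>' at the single point 0 suffices for
  this.\<close>

lemma second_derivative_nonpos_at_local_max:
  fixes \<phi> \<phi>' :: "real \<Rightarrow> real"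
  assumes \<delta>: "\<delta> > 0"
    and d: "\<And>t. \<bar>t\<bar> < \<delta> \<Longrightarrow> (\<phi> has_real_derivative \<phi>' t) (at t)"
    and d2: "(\<phi>' has_real_derivative c) (at 0)"
    and max: "\<And>t. \<bar>t\<bar> < \<delta> \<Longrightarrow> \<phi> t \<le> \<phi> 0"
  shows "c \<le> 0"
proof (rule ccontr)
  assume "\<not> c \<le> 0"
  then have "0 < c" by simp
  have "\<phi>' 0 = 0"
    using DERIV_local_max[OF d[of 0] \<delta>] \<delta> max by auto
  moreover obtain d where d': "d > 0" "\<And>h. 0 < h \<Longrightarrow> h < d \<Longrightarrow> \<phi>' 0 < \<phi>' (0 + h)"
    using DERIV_pos_inc_right[OF d2 \<open>0 < c\<close>] by blast
  ultimately have pos: "0 < \<phi>' h" if "0 < h" "h < d" for h using that by simp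
  define t where "t = min d \<delta> / 2"
  have t: "0 < t" "t < d" "t < \<delta>" using d' \<delta> by (auto simp: t_def)
  have "\<phi> 0 < \<phi> t"
  proof (rule DERIV_pos_imp_increasing_open[OF t(1)])
    fix x assume "0 < x" "x < t"
    then show "\<exists>y. (\<phi> has_real_derivative y) (at x) \<and> 0 < y"
      using assms(2)[of x] pos[of x] t by auto
  next
    show "continuous_on {0..t} \<phi>"
      using t by (intro continuous_at_imp_continuous_on ballI DERIV_isCont[OF assms(2)]) auto
  qed
  then show False using max[of t] t by simp
qed

lemma has_real_derivative_along_axis:
  fixes f :: "real^'n \<Rightarrow> real"
  assumes "(f has_derivative (\<lambda>v. g \<bullet> v)) (at x)"
  shows "((\<lambda>t. f (x + t *\<^sub>R axis i 1)) has_real_derivative g $ i) (at 0)"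
proof -
  have l: "((\<lambda>t::real. x + t *\<^sub>R axis i 1) has_derivative (\<lambda>t. t *\<^sub>R axis i 1)) (at 0)"
    by (auto intro!: derivative_eq_intros)
  have "(f \<circ> (\<lambda>t. x + t *\<^sub>R axis i 1) has_derivative (\<lambda>v. g \<bullet> v) \<circ> (\<lambda>t. t *\<^sub>R axis i 1)) (at 0)"
    by (rule diff_chain_at[OF l]) (use assms in simp)
  then show ?thesis
    by (simp add: has_field_derivative_def o_def inner_axis mult_commute_abs)
qed

lemma has_real_derivative_gradient_along_axis:
  fixes g :: "real^'n \<Rightarrow> real^'n"
  assumes "(g has_derivative (\<lambda>v. H *v v)) (at x)"
  shows "((\<lambda>t. g (x + t *\<^sub>R axis i 1) $ i) has_real_derivative H $ i $ i) (at 0)"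
proof -
  have l: "((\<lambda>t::real. x + t *\<^sub>R axis i 1) has_derivative (\<lambda>t. t *\<^sub>R axis i 1)) (at 0)"
    by (auto intro!: derivative_eq_intros)
  have "(g \<circ> (\<lambda>t. x + t *\<^sub>R axis i 1) has_derivative (\<lambda>v. H *v v) \<circ> (\<lambda>t. t *\<^sub>R axis i 1)) (at 0)"
    by (rule diff_chain_at[OF l]) (use assms in simp)
  from bounded_linear.has_derivative[OF bounded_linear_vec_nth[of i] this] show ?thesis
    by (simp add: has_field_derivative_def o_def mult_commute_abs
        matrix_vector_mult_scaleR matrix_vector_mult_basis column_def)
qed

lemma laplacian_eq_trace:
  fixes f :: "real^'n \<Rightarrow> real"
  assumes S: "open S" and x: "x \<in> S"
    and g: "\<forall>x\<in>S. (f has_derivative (\<lambda>v. g x \<bullet> v)) (at x)"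
    and H: "\<forall>x\<in>S. (g has_derivative (\<lambda>v. H x *v v)) (at x)"
  shows "laplacian f x = (\<Sum>i\<in>UNIV. H x $ i $ i)"
proof -
  have p1: "partial_deriv i f y = g y $ i" if "y \<in> S" for i y
    unfolding partial_deriv_def by (rule DERIV_imp_deriv, rule has_real_derivative_along_axis) (use g that in blast)
  have "partial_deriv i (partial_deriv i f) x = H x $ i $ i" for i
  proof -
    obtain r where r: "r > 0" "ball x r \<subseteq> S" using S x open_contains_ball by blast
    have "((\<lambda>t. g (x + t *\<^sub>R axis i 1) $ i) has_real_derivative H x $ i $ i) (at 0)"
      by (rule has_real_derivative_gradient_along_axis) (use H x in blast)
    then have "((\<lambda>t. partial_deriv i f (x + t *\<^sub>R axis i 1)) has_real_derivative H x $ i $ i) (at 0)"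
    proof (rule has_field_derivative_transform_within[OF _ r(1)])
      fix t :: real assume "dist t 0 < r"
      then have "x + t *\<^sub>R axis i 1 \<in> ball x r" by (simp add: dist_norm)
      then show "g (x + t *\<^sub>R axis i 1) $ i = partial_deriv i f (x + t *\<^sub>R axis i 1)"
        using p1 r by auto
    qed simp
    then show ?thesis unfolding partial_deriv_def[of i "partial_deriv i f"] by (rule DERIV_imp_deriv)
  qed
  then show ?thesis by (simp add: laplacian_def)
qed

text \<open>The maximum principle tests u - h only along coordinate lines, so the Laplacian of u is
  supplied as a sum of one-dimensional second derivatives.\<close>

lemma subharmonic_onI:
  fixes u :: "real^'n \<Rightarrow> real" and D DD :: "'n \<Rightarrow> real^'n \<Rightarrow> real"
  assumes S: "open S" and u: "continuous_on S u"
    and d: "\<And>x i. x \<in> S \<Longrightarrow> ((\<lambda>t. u (x + t *\<^sub>R axis i 1)) has_real_derivative D i x) (at 0)"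
    and d2: "\<And>x i. x \<in> S \<Longrightarrow> ((\<lambda>t. D i (x + t *\<^sub>R axis i 1)) has_real_derivative DD i x) (at 0)"
    and sum: "\<And>x. x \<in> S \<Longrightarrow> 0 \<le> (\<Sum>i\<in>UNIV. DD i x)"
  shows "subharmonic_on S u"
  unfolding subharmonic_on_def
proof (intro conjI allI impI ballI)
  show "upper_semicontinuous_on S u"
    unfolding upper_semicontinuous_on_def
  proof (intro ballI allI impI)
    fix x a assume "x \<in> S" "u x < a"
    then show "\<forall>\<^sub>F y in at x within S. u y < a"
      using u by (intro order_tendstoD(2)[of u "u x"]) (auto simp: continuous_on_def)
  qed
next
  fix c :: "real^'n" and r :: real and h x0
  assume r: "0 < r" and sub: "cball c r \<subseteq> S" and hc: "continuous_on (cball c r) h"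
    and harm: "harmonic_on (ball c r) h" and bd: "\<forall>x\<in>sphere c r. u x \<le> h x" and x0: "x0 \<in> ball c r"
  show "u x0 \<le> h x0"
  proof (rule ccontr)
    assume "\<not> u x0 \<le> h x0"
    \<comment> \<open>Adding \<epsilon> |y - c|^2 makes the sum of second derivatives strictly
      positive. With this \<epsilon> the addition is only \<epsilon> r^2 on the sphere, half of the
      excess 2 \<epsilon> r^2 at \<open>x0\<close>, so the maximum of w lies in the open
      ball.\<close>
    define \<epsilon> where "\<epsilon> = (u x0 - h x0) / (2 * r\<^sup>2)"
    have \<epsilon>: "0 < \<epsilon>" "u x0 - h x0 = 2 * \<epsilon> * r\<^sup>2"
      using r \<open>\<not> u x0 \<le> h x0\<close> by (auto simp: \<epsilon>_def)
    obtain g H where g: "\<forall>x\<in>ball c r. (h has_derivative (\<lambda>v. g x \<bullet> v)) (at x)"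
      and H: "\<forall>x\<in>ball c r. (g has_derivative (\<lambda>v. H x *v v)) (at x)"
      and lap: "\<forall>x\<in>ball c r. laplacian h x = 0"
      using harm unfolding harmonic_on_def C2_on_def by blast
    define w where "w y = u y - h y + \<epsilon> * ((y - c) \<bullet> (y - c))" for y
    have "continuous_on (cball c r) w"
      unfolding w_def using continuous_on_subset[OF u sub] hc by (intro continuous_intros)
    then obtain z where z: "z \<in> cball c r" "\<And>y. y \<in> cball c r \<Longrightarrow> w y \<le> w z"
      using continuous_attains_sup[of "cball c r" w] r by auto
    have "2 * \<epsilon> * r\<^sup>2 \<le> w x0" using \<epsilon> by (simp add: w_def)
    also have "w x0 \<le> w z" using z x0 by simp
    finally have wz: "2 * \<epsilon> * r\<^sup>2 \<le> w z" .
    have zb: "z \<in> ball c r"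
    proof (rule ccontr)
      assume "z \<notin> ball c r"
      then have zs: "z \<in> sphere c r" using z(1) by auto
      then have "(z - c) \<bullet> (z - c) = r\<^sup>2"
        by (simp add: dist_norm norm_minus_commute power2_norm_eq_inner[symmetric])
      then have "w z \<le> \<epsilon> * r\<^sup>2" using bd zs by (simp add: w_def)
      moreover have "0 < \<epsilon> * r\<^sup>2" using \<epsilon> r by simp
      ultimately show False using wz by simp
    qed
    obtain \<delta> where \<delta>: "\<delta> > 0" "ball z \<delta> \<subseteq> ball c r" using zb open_contains_ball by blast
    have near: "z + t *\<^sub>R axis i 1 \<in> ball c r" if "\<bar>t\<bar> < \<delta>" for t i
    proof -
      have "z + t *\<^sub>R axis i 1 \<in> ball z \<delta>" using that by (simp add: dist_norm)
      then show ?thesis using \<delta> by blast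
    qed
    have bS: "y \<in> S" if "y \<in> ball c r" for y using that sub by auto
    have "DD i z - H z $ i $ i + 2 * \<epsilon> \<le> 0" for i
    proof (rule second_derivative_nonpos_at_local_max[OF \<delta>(1)])
      fix t :: real assume t: "\<bar>t\<bar> < \<delta>"
      let ?y = "z + t *\<^sub>R axis i 1"
      show "w ?y \<le> w (z + 0 *\<^sub>R axis i 1)" using z(2)[of ?y] near[OF t, of i] by simp
      have "((\<lambda>s. w (?y + s *\<^sub>R axis i 1)) has_real_derivative
          D i ?y - g ?y $ i + \<epsilon> * (2 * (?y - c) $ i)) (at 0)"
        unfolding w_def
      proof (intro DERIV_add DERIV_diff DERIV_cmult)
        show "((\<lambda>s. u (?y + s *\<^sub>R axis i 1)) has_real_derivative D i ?y) (at 0)"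
          by (rule d[OF bS[OF near[OF t]]])
        show "((\<lambda>s. h (?y + s *\<^sub>R axis i 1)) has_real_derivative g ?y $ i) (at 0)"
          by (rule has_real_derivative_along_axis) (use g near[OF t] in blast)
        have "((\<lambda>y. (y - c) \<bullet> (y - c)) has_derivative (\<lambda>v. (2 *\<^sub>R (?y - c)) \<bullet> v)) (at ?y)"
          by (auto intro!: derivative_eq_intros simp: inner_commute fun_eq_iff)
        from has_real_derivative_along_axis[OF this, of i]
        show "((\<lambda>s. (?y + s *\<^sub>R axis i 1 - c) \<bullet> (?y + s *\<^sub>R axis i 1 - c)) has_real_derivative 2 * (?y - c) $ i) (at 0)"
          by simp
      qed
      then show "((\<lambda>t. w (z + t *\<^sub>R axis i 1)) has_real_derivative
          D i ?y - g ?y $ i + \<epsilon> * (2 * (?y - c) $ i)) (at t)"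
        using DERIV_shift[of "\<lambda>t. w (z + t *\<^sub>R axis i 1)" _ 0 t] by (simp add: algebra_simps)
    next
      have "((\<lambda>t. D i (z + t *\<^sub>R axis i 1)) has_real_derivative DD i z) (at 0)"
        by (rule d2[OF bS[OF zb]])
      moreover have "((\<lambda>t. g (z + t *\<^sub>R axis i 1) $ i) has_real_derivative H z $ i $ i) (at 0)"
        by (rule has_real_derivative_gradient_along_axis) (use H zb in blast)
      moreover have "((\<lambda>t. \<epsilon> * (2 * (z + t *\<^sub>R axis i 1 - c) $ i)) has_real_derivative 2 * \<epsilon>) (at 0)"
        by (auto intro!: derivative_eq_intros simp: axis_def)
      ultimately show "((\<lambda>t. D i (z + t *\<^sub>R axis i 1) - g (z + t *\<^sub>R axis i 1) $ i
          + \<epsilon> * (2 * (z + t *\<^sub>R axis i 1 - c) $ i)) has_real_derivative DD i z - H z $ i $ i + 2 * \<epsilon>) (at 0)"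
        by (intro DERIV_add DERIV_diff)
    qed
    then have "(\<Sum>i\<in>UNIV. DD i z - H z $ i $ i + 2 * \<epsilon>) \<le> 0" by (intro sum_nonpos) auto
    moreover have "(\<Sum>i\<in>UNIV. H z $ i $ i) = 0"
      using laplacian_eq_trace[OF open_ball zb g H] lap zb by simp
    ultimately have "(\<Sum>i\<in>UNIV. DD i z) + 2 * \<epsilon> * real CARD('n) \<le> 0"
      by (simp add: sum.distrib sum_subtractf mult_ac)
    moreover have "0 < 2 * \<epsilon> * real CARD('n)" using \<epsilon> by simp
    ultimately show False using sum[OF bS[OF zb]] by simp
  qed
qed (rule S)

section \<open>The profile transform\<close>

text \<open>The complement of the support is a union of open sets on each of which \<rho> vanishes
  almost everywhere. Countably many of them suffice by the Lindelof property, so the exceptional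
  null sets can be united.\<close>

lemma essential_support_AE:
  fixes \<rho> :: "real^'n \<Rightarrow> real"
  shows "AE z in lebesgue. z \<notin> essential_support \<rho> \<longrightarrow> \<rho> z = 0"
proof -
  define F where "F = {U. open U \<and> (AE y in lebesgue. y \<in> U \<longrightarrow> \<rho> y = 0)}"
  obtain F' where F': "F' \<subseteq> F" "countable F'" "\<Union>F' = \<Union>F"
    by (rule Lindelof[of F]) (auto simp: F_def)
  have "AE y in lebesgue. \<forall>U\<in>F'. y \<in> U \<longrightarrow> \<rho> y = 0"
    using F' by (intro AE_ball_countable') (auto simp: F_def)
  then show ?thesis
  proof eventually_elim
    case (elim z)
    show ?case
    proof
      assume "z \<notin> essential_support \<rho>"
      then have "z \<in> \<Union>F" by (auto simp: essential_support_def F_def)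
      then show "\<rho> z = 0" using elim F' by blast
    qed
  qed
qed

text \<open>The cone over the sphere is the ball without its centre. Hence the constant n/\<omega>_n
  of the potential is 1/w.\<close>

lemma unit_sphere_measure_sphere:
  "unit_sphere_measure (sphere (0::real^'n) 1) = real CARD('n) * measure lebesgue (cball (0::real^'n) 1)"
proof -
  have "{t *\<^sub>R a | t a. 0 < t \<and> t \<le> 1 \<and> a \<in> sphere (0::real^'n) 1} = cball 0 1 - {0}"
  proof (intro set_eqI iffI)
    fix x :: "real^'n" assume x: "x \<in> cball 0 1 - {0}"
    then have "x = norm x *\<^sub>R (x /\<^sub>R norm x)" "0 < norm x" "norm x \<le> 1" "x /\<^sub>R norm x \<in> sphere 0 1"
      by auto
    then show "x \<in> {t *\<^sub>R a | t a. 0 < t \<and> t \<le> 1 \<and> a \<in> sphere (0::real^'n) 1}" by blast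
  qed auto
  moreover have "measure lebesgue (cball (0::real^'n) 1 - {0}) = measure lebesgue (cball (0::real^'n) 1)"
    by (rule measure_Diff_null_set) (auto simp: null_sets_completionI)
  ultimately show ?thesis by (simp add: unit_sphere_measure_def)
qed

lemma inverse_norm_power_eq_sqdist_powr:
  fixes x z :: "'a::euclidean_space"
  assumes "x \<noteq> z"
  shows "1 / norm (x - z) ^ n = sqdist x z powr (- real n / 2)"
proof -
  have "sqdist x z = norm (x - z) powr 2"
    using assms by (simp add: sqdist_def power2_norm_eq_inner[symmetric] norm_minus_commute)
  then have "sqdist x z powr (- real n / 2) = norm (x - z) powr (- real n)"
    by (simp only: powr_powr) simp
  then show ?thesis using assms by (simp add: powr_minus_divide powr_realpow)
qed

text \<open>K may be any compact set that carries \<rho> up to a null set, which covers both the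
  essential support and a closed ball.\<close>

lemma potential_eq_pot:
  fixes K :: "(real^'n) set"
  assumes "weighted_compact K \<rho>" and x: "x \<notin> K"
    and ae: "AE z in lebesgue. z \<notin> K \<longrightarrow> \<rho> z = 0"
  shows "potential \<rho> x = weighted_compact.pot K \<rho> (- real CARD('n) / 2) x / measure lebesgue (cball (0::real^'n) 1)"
proof -
  interpret weighted_compact K \<rho> by fact
  have i: "set_integrable lebesgue K (\<lambda>z. \<rho> z * sqdist x z powr (- real CARD('n) / 2))"
    by (intro weighted_integrable continuous_on_sqdist_powr x)
  have m: "(\<lambda>z. \<rho> z / norm (x - z) ^ CARD('n)) \<in> borel_measurable lebesgue"
  proof (rule borel_measurable_divide[OF \<rho>(1)])
    have "(\<lambda>z. norm (x - z) ^ CARD('n)) \<in> borel_measurable borel"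
      by (intro borel_measurable_continuous_onI continuous_intros)
    then show "(\<lambda>z. norm (x - z) ^ CARD('n)) \<in> borel_measurable lebesgue"
      by (intro measurable_completion) auto
  qed
  have "(LINT z|lebesgue. \<rho> z / norm (x - z) ^ CARD('n)) = pot (- real CARD('n) / 2) x"
    unfolding pot_def set_lebesgue_integral_def
  proof (rule integral_cong_AE[OF m])
    show "(\<lambda>z. indicat_real K z *\<^sub>R (\<rho> z * sqdist x z powr (- real CARD('n) / 2))) \<in> borel_measurable lebesgue"
      using i by (simp add: set_integrable_def borel_measurable_integrable)
    show "AE z in lebesgue. \<rho> z / norm (x - z) ^ CARD('n) =
        indicat_real K z *\<^sub>R (\<rho> z * sqdist x z powr (- real CARD('n) / 2))"
      using ae
    proof eventually_elim
      case (elim z)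
      show ?case
      proof (cases "z \<in> K")
        case True
        then have "x \<noteq> z" using x by metis
        have "\<rho> z / norm (x - z) ^ CARD('n) = \<rho> z * (1 / norm (x - z) ^ CARD('n))" by simp
        also have "\<dots> = \<rho> z * sqdist x z powr (- real CARD('n) / 2)"
          by (simp only: inverse_norm_power_eq_sqdist_powr[OF \<open>x \<noteq> z\<close>])
        finally show ?thesis using True by simp
      qed (use elim in simp)
    qed
  qed
  then show ?thesis by (simp add: potential_def unit_sphere_measure_sphere)
qed

subsection \<open>Subharmonicity\<close>

text \<open>The exponent (n - 2)/n is the one for which differentiation leaves M^(-2/n) M' =
  M^(-2/n) - 1; for n = 2 this is M'/M, so the logarithm fits the same formula with \<alpha> =
  1.\<close>

lemma profile_transform_derivatives:
  fixes n :: nat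
  assumes n: "n \<ge> 2"
    and F: "F = (\<lambda>v. if n = 2 then ln (profile 2 v) else profile n v powr ((real n - 2) / real n))"
    and \<alpha>: "\<alpha> = (if n = 2 then 1 else (real n - 2) / real n)"
    and v: "0 < v"
  shows "(F has_real_derivative \<alpha> * (profile n v powr (- 2 / n) - 1)) (at v)"
    and "((\<lambda>v. \<alpha> * (profile n v powr (- 2 / n) - 1)) has_real_derivative
      - (2 * \<alpha> / n) * (profile n v powr (- 2 / n - 1) * (1 - profile n v powr (2 / n)))) (at v)"
proof -
  have M: "0 < profile n v" "(profile n has_real_derivative (1 - profile n v powr (2 / n))) (at v)"
    by (rule profile_pos[OF n v]) (rule profile_has_real_derivative[OF n v])
  show "((\<lambda>v. \<alpha> * (profile n v powr (- 2 / n) - 1)) has_real_derivative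
      - (2 * \<alpha> / n) * (profile n v powr (- 2 / n - 1) * (1 - profile n v powr (2 / n)))) (at v)"
  proof -
    have "((\<lambda>v. \<alpha> * (profile n v powr (- 2 / n) - 1)) has_real_derivative
       \<alpha> * ((- 2 / n) * profile n v powr (- 2 / n - 1) * (1 - profile n v powr (2 / n)) - 0)) (at v)"
      using DERIV_powr[OF M(2) M(1) DERIV_const[of "- 2 / n"]] M(1)
      by (intro DERIV_cmult DERIV_diff DERIV_const) (auto simp: powr_diff elim!: DERIV_cong)
    then show ?thesis by (rule DERIV_cong) simp
  qed
  show "(F has_real_derivative \<alpha> * (profile n v powr (- 2 / n) - 1)) (at v)"
  proof (cases "n = 2")
    case True
    have "((\<lambda>v. ln (profile n v)) has_real_derivative 1 / profile n v * (1 - profile n v powr (2 / n))) (at v)"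
      by (rule DERIV_chain2[OF DERIV_ln_divide M(2)]) (rule M)
    then show ?thesis
      using M(1) True by (simp add: F \<alpha> powr_minus_divide diff_divide_distrib)
  next
    case False
    have "((\<lambda>v. profile n v powr \<alpha>) has_real_derivative
        \<alpha> * profile n v powr (\<alpha> - 1) * (1 - profile n v powr (2 / n))) (at v)"
      using DERIV_powr[OF M(2) M(1) DERIV_const[of \<alpha>]] M(1)
      by (auto simp: powr_diff elim!: DERIV_cong)
    moreover have "\<alpha> - 1 = - 2 / n" using False n by (simp add: \<alpha> field_simps)
    moreover have "profile n v powr (- 2 / n) * profile n v powr (2 / n) = 1"
      using M(1) by (simp add: powr_add[symmetric])
    ultimately show ?thesis
      using False by (simp add: F \<alpha> right_diff_distrib mult.assoc)
  qed
qed

lemma profile_transform_subharmonic: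
  fixes \<rho> :: "real^'n \<Rightarrow> real"
  assumes n: "CARD('n) \<ge> 2" and \<rho>: "density_function \<rho>"
    and nz: "CARD('n) = 2 \<longrightarrow> emeasure lebesgue {x. \<rho> x \<noteq> 0} > 0"
  shows "subharmonic_on (- essential_support \<rho>) (profile_transform \<rho>)"
proof -
  define K where "K = essential_support \<rho>"
  interpret weighted_compact K \<rho>
    using \<rho> unfolding density_function_def K_def by unfold_locales auto
  note ae = essential_support_AE[of \<rho>, folded K_def]
  define n where "n = CARD('n)"
  define w where "w = measure lebesgue (cball (0::real^'n) 1)"
  have w0: "0 < w" unfolding w_def using content_cball_pos[of 1 "0::real^'n"] by simp
  define a where "a = - real n / 2"
  have dim: "DIM(real^'n) = n" by (simp add: n_def)
  have n2: "n \<ge> 2" using n by (simp add: n_def)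
  have S: "open (- K)" using closed_K by (simp add: open_Compl)
  define F where "F = (\<lambda>v. if n = 2 then ln (profile 2 v) else profile n v powr ((real n - 2) / real n))"
  define \<alpha> where "\<alpha> = (if n = 2 then 1 else (real n - 2) / real n)"
  have \<alpha>0: "0 \<le> \<alpha>" using n2 by (simp add: \<alpha>_def)
  define V where "V x = pot a x / w" for x
  have u: "profile_transform \<rho> x = F (V x)" if "x \<notin> K" for x
    using potential_eq_pot[OF weighted_compact_axioms that ae]
    by (simp add: profile_transform_def F_def V_def w_def a_def n_def)
  have V0: "0 \<le> V x" for x using pot_nonneg[of a x] w0 by (simp add: V_def)
  have "subharmonic_on (- K) (profile_transform \<rho>)"
  \<comment> \<open>The derivatives of the profile and of F are available only at positive
    arguments. A zero of the potential off K forces \<rho> to vanish almost everywhere, since the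
    kernel is positive.\<close>
  proof (cases "\<exists>x. x \<notin> K \<and> pot a x = 0")
    case True
    then obtain x where x: "x \<notin> K" "pot a x = 0" by blast
    have "AE z in lebesgue. indicat_real K z *\<^sub>R (\<rho> z * sqdist x z powr a) = 0"
    proof (subst integral_nonneg_eq_0_iff_AE[symmetric])
      show "integrable lebesgue (\<lambda>z. indicat_real K z *\<^sub>R (\<rho> z * sqdist x z powr a))"
        using weighted_integrable[OF continuous_on_sqdist_powr[OF x(1)]] by (simp add: set_integrable_def)
      show "AE z in lebesgue. 0 \<le> indicat_real K z *\<^sub>R (\<rho> z * sqdist x z powr a)"
        using \<rho>(2) by (auto intro!: AE_I2 simp: indicator_def)
      show "(LINT z|lebesgue. indicat_real K z *\<^sub>R (\<rho> z * sqdist x z powr a)) = 0"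
        using x(2) by (simp add: pot_def set_lebesgue_integral_def)
    qed
    with ae have zero: "AE z in lebesgue. \<rho> z = 0"
    proof eventually_elim
      case (elim z)
      show ?case
      proof (cases "z \<in> K")
        case True
        then have "x \<noteq> z" using x(1) by metis
        from sqdist_pos[OF this] elim True show ?thesis by simp
      qed (use elim in simp)
    qed
    \<comment> \<open>The assumption for the plane excludes the zero density, for which the
      logarithm would be taken at 0. In higher dimensions the transform is then the constant
      0.\<close>
    have "n \<noteq> 2"
    proof
      assume "n = 2"
      then have "emeasure lebesgue {x. \<rho> x \<noteq> 0} > 0" using nz by (simp add: n_def)
      moreover have "emeasure lebesgue {x. \<rho> x \<noteq> 0} = 0"
      proof -
        have "{x \<in> space lebesgue. \<rho> x \<noteq> 0} \<in> sets lebesgue" using \<rho>(1) by measurable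
        then have "{x. \<rho> x \<noteq> 0} \<in> null_sets lebesgue"
          using zero AE_iff_null_sets[of "{x. \<rho> x \<noteq> 0}" lebesgue] by simp
        then show ?thesis by blast
      qed
      ultimately show False by simp
    qed
    moreover have "pot a y = 0" for y
      unfolding pot_def set_lebesgue_integral_def
      by (rule integral_eq_zero_AE) (use zero in \<open>eventually_elim, simp\<close>)
    ultimately have u0: "profile_transform \<rho> y = 0" if "y \<notin> K" for y
      using u[OF that] profile_0[OF n2] by (simp add: F_def V_def)
    show ?thesis
    proof (rule subharmonic_onI[OF S, where D = "\<lambda>_ _. 0" and DD = "\<lambda>_ _. 0"])
      show "continuous_on (- K) (profile_transform \<rho>)"
        using u0 continuous_on_cong[of "- K" "- K" "profile_transform \<rho>" "\<lambda>_. 0"] by simp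
      fix y :: "real^'n" and i assume y: "y \<in> - K"
      then obtain \<delta> where \<delta>: "\<delta> > 0" "\<And>t. \<bar>t\<bar> \<le> \<delta> \<Longrightarrow> y + t *\<^sub>R axis i 1 \<notin> K"
        using line_avoids_closed[OF closed_K, of y "axis i 1"] by auto
      show "((\<lambda>t. profile_transform \<rho> (y + t *\<^sub>R axis i 1)) has_real_derivative 0) (at 0)"
        by (rule has_field_derivative_transform_within[OF DERIV_const[of 0] \<delta>(1)]) (use u0 \<delta>(2) in auto)
    qed auto
  next
    case False
    then have V: "0 < V x" if "x \<notin> K" for x
      using that pot_nonneg[of a x] w0 by (force simp: V_def less_le)
    define A where "A x = grad_pot (a - 1) x" for x
    define D where "D i x = \<alpha> * (profile n (V x) powr (- 2 / n) - 1) * ((real n / w) * A x $ i)" for i x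
    \<comment> \<open>F''(V) times the square of the i-th derivative of V, plus F'(V) times its
      second derivative.\<close>
    define D2 where "D2 i x =
        (- (2 * \<alpha> / n) * (profile n (V x) powr (- 2 / n - 1) * (1 - profile n (V x) powr (2 / n))))
          * ((real n / w) * A x $ i)\<^sup>2
      + \<alpha> * (profile n (V x) powr (- 2 / n) - 1)
          * ((real n / w) * ((real n + 2) * hess_pot (a - 1 - 1) (axis i 1) x - pot (a - 1) x))" for i x
    have dV: "((\<lambda>t. V (x + t *\<^sub>R axis i 1)) has_real_derivative (real n / w) * A x $ i) (at 0)" if "x \<notin> K" for x i
    proof -
      have "((\<lambda>t. pot a (x + t *\<^sub>R axis i 1) / w) has_real_derivative
          - 2 * a * (grad_pot (a - 1) x \<bullet> axis i 1) / w) (at 0)"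
        by (rule DERIV_cdivide[OF pot_has_real_derivative[OF that]]) simp
      then show ?thesis by (simp add: V_def A_def a_def inner_axis)
    qed
    have dA: "((\<lambda>t. (real n / w) * A (x + t *\<^sub>R axis i 1) $ i) has_real_derivative
        (real n / w) * ((real n + 2) * hess_pot (a - 1 - 1) (axis i 1) x - pot (a - 1) x)) (at 0)" if "x \<notin> K" for x i
    proof -
      have "((\<lambda>t. grad_pot (a - 1) (x + t *\<^sub>R axis i 1) \<bullet> axis i 1) has_real_derivative
          - 2 * (a - 1) * hess_pot (a - 1 - 1) (axis i 1) x - pot (a - 1) x) (at 0)"
        by (rule grad_pot_has_real_derivative[OF that]) simp
      moreover have "- 2 * (a - 1) = real n + 2" by (simp add: a_def)
      ultimately have "((\<lambda>t. A (x + t *\<^sub>R axis i 1) $ i) has_real_derivative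
          (real n + 2) * hess_pot (a - 1 - 1) (axis i 1) x - pot (a - 1) x) (at 0)"
        by (simp only: A_def inner_axis) simp
      then show ?thesis by (rule DERIV_cmult)
    qed
    show ?thesis
    proof (rule subharmonic_onI[OF S, where D = D and DD = D2])
      show "continuous_on (- K) (profile_transform \<rho>)"
      proof -
        have "continuous_on (- K) (\<lambda>x. F (V x))"
        proof (rule continuous_on_compose2[of "{0<..}" F "- K" V])
          show "continuous_on {0<..} F"
            by (intro continuous_at_imp_continuous_on ballI,
              rule DERIV_isCont[OF profile_transform_derivatives(1)[OF n2 F_def \<alpha>_def]]) simp
          show "continuous_on (- K) V"
            unfolding V_def using continuous_on_pot w0 by (intro continuous_intros) auto
          show "V ` (- K) \<subseteq> {0<..}" using V by auto
        qed
        then show ?thesis using u continuous_on_cong[of "- K" "- K" "profile_transform \<rho>" "\<lambda>x. F (V x)"] by simp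
      qed
    next
      fix x :: "real^'n" and i assume "x \<in> - K"
      then have x: "x \<notin> K" by simp
      obtain \<delta> where \<delta>: "\<delta> > 0" "\<And>t. \<bar>t\<bar> \<le> \<delta> \<Longrightarrow> x + t *\<^sub>R axis i 1 \<notin> K"
        using line_avoids_closed[OF closed_K x, of "axis i 1"] by auto
      have Vx: "0 < V (x + 0 *\<^sub>R axis i 1)" using V[OF x] by simp
      have "((\<lambda>t. F (V (x + t *\<^sub>R axis i 1))) has_real_derivative D i x) (at 0)"
        using DERIV_chain2[OF profile_transform_derivatives(1)[OF n2 F_def \<alpha>_def Vx] dV[OF x]]
        by (simp add: D_def)
      then show "((\<lambda>t. profile_transform \<rho> (x + t *\<^sub>R axis i 1)) has_real_derivative D i x) (at 0)"
        by (rule has_field_derivative_transform_within[OF _ \<delta>(1)]) (use u \<delta>(2) in auto)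
      show "((\<lambda>t. D i (x + t *\<^sub>R axis i 1)) has_real_derivative D2 i x) (at 0)"
        using DERIV_mult[OF DERIV_chain2[OF profile_transform_derivatives(2)[OF n2 F_def \<alpha>_def Vx] dV[OF x]] dA[OF x]]
        unfolding D_def D2_def by (rule DERIV_cong) (simp add: power2_eq_square mult_ac)
    next
      fix x :: "real^'n" assume "x \<in> - K"
      then have x: "x \<notin> K" by simp
      define m where "m = profile n (V x)"
      define b where "b = pot (a - 1) x"
      have m: "0 < m" "m < 1"
        unfolding m_def using profile_pos[OF n2 V[OF x]] profile_less_1[OF n2 V0] by auto
      have est: "(norm (A x))\<^sup>2 \<le> w * m * b"
      proof -
        have "(norm (grad_pot (- real DIM(real^'n) / 2 - 1) x))\<^sup>2
            \<le> w * profile DIM(real^'n) (pot (- real DIM(real^'n) / 2) x / w) * pot (- real DIM(real^'n) / 2 - 1) x"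
        proof (rule gradient_estimate[OF x _ w_def])
          show "0 < pot (- real DIM(real^'n) / 2) x" unfolding dim using V[OF x] w0 by (simp add: V_def a_def zero_less_divide_iff)
        qed (use n2 dim in simp)
        then show ?thesis by (simp only: dim A_def m_def b_def V_def a_def)
      qed
      have Asum: "(\<Sum>i\<in>UNIV. (A x $ i)\<^sup>2) = (norm (A x))\<^sup>2"
        unfolding power2_norm_eq_inner by (simp add: inner_vec_def power2_eq_square)
      have Hsum: "(\<Sum>i\<in>UNIV. hess_pot (a - 1 - 1) (axis i 1) x) = b"
      proof -
        have B: "Basis = (\<lambda>i. axis i (1::real) :: real^'n) ` UNIV" by (auto simp: Basis_vec_def)
        have "inj (\<lambda>i. axis i (1::real) :: real^'n)" by (auto simp: inj_on_def axis_eq_axis)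
        then show ?thesis using sum_hess_pot[OF x, of "a - 1"] by (simp add: B sum.reindex b_def o_def)
      qed
      have mm: "m powr (- 2 / n) = m powr (- 2 / n - 1) * m" using m by (simp add: powr_diff)
      have mm2: "m powr (- 2 / n) * m powr (2 / n) = 1" using m by (simp add: powr_add[symmetric])
      \<comment> \<open>The common factor of both derivatives: F'(V) = \<alpha> \<beta> m and F''(V)
        = -(2 \<alpha>/n) \<beta>.\<close>
      define \<beta> where "\<beta> = m powr (- 2 / n - 1) * (1 - m powr (2 / n))"
      have "m powr (2 / n) < 1" using m n2 powr_less_mono2[of "2 / n" m 1] by simp
      then have \<beta>: "0 \<le> \<beta>" using m by (simp add: \<beta>_def)
      have \<beta>m: "m powr (- 2 / n) - 1 = \<beta> * m"
        using mm mm2 by (simp add: \<beta>_def algebra_simps)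
      have "(\<Sum>i\<in>UNIV. D2 i x) = - (2 * \<alpha> / n) * \<beta> * ((real n / w)\<^sup>2 * (\<Sum>i\<in>UNIV. (A x $ i)\<^sup>2))
         + \<alpha> * (\<beta> * m) * ((real n / w) * ((real n + 2) * (\<Sum>i\<in>UNIV. hess_pot (a - 1 - 1) (axis i 1) x) - n * b))"
        unfolding D2_def m_def[symmetric] b_def[symmetric] \<beta>_def[symmetric] \<beta>m
        by (simp only: sum.distrib sum_distrib_left[symmetric] sum_subtractf power_mult_distrib sum_constant n_def[symmetric])
      \<comment> \<open>The trace of the second moments is b, so the Laplacian of V is (n/w) ((n +
        2) b - n b) = 2 n b / w. The last factor is the one controlled by
        \<open>gradient_estimate\<close>.\<close>
      also have "\<dots> = (2 * \<alpha> * n / w\<^sup>2) * \<beta> * (w * m * b - (norm (A x))\<^sup>2)"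
        unfolding Asum Hsum using n2 w0 by (simp add: field_simps power2_eq_square)
      also have "\<dots> \<ge> 0" using \<alpha>0 \<beta> est by (intro mult_nonneg_nonneg) auto
      finally show "0 \<le> (\<Sum>i\<in>UNIV. D2 i x)" .
    qed
  qed
  then show ?thesis by (simp add: K_def)
qed

subsection \<open>Balls\<close>

text \<open>By \<open>integral_W\<close> the potential of the ball is G((r/|x - b|)^n), and the
  profile inverts G.\<close>

lemma profile_potential_cball:
  fixes b x :: "real^'n"
  assumes n: "CARD('n) \<ge> 2" and r: "0 < r" and x: "x \<notin> cball b r"
  shows "profile CARD('n) (potential (indicator (cball b r)) x) = (r / norm (x - b)) ^ CARD('n)"
proof -
  define K where "K = cball b r"
  define R where "R = norm (b - x)"
  define w where "w = measure lebesgue (cball (0::real^'n) 1)"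
  have w0: "0 < w" unfolding w_def using content_cball_pos[of 1 "0::real^'n"] by simp
  have rR: "r < R" using x by (simp add: R_def dist_norm norm_minus_commute)
  have xK: "x \<notin> K" using x by (simp add: K_def)
  interpret weighted_compact K "indicator K"
  proof unfold_locales
    show "indicat_real K \<in> borel_measurable lebesgue"
      by (rule borel_measurable_indicator) (simp add: K_def)
  qed (auto simp: K_def)
  interpret ball_integrals "b - x" "CARD('n)" by standard simp
  obtain G where G: "G 0 = 0"
     "\<And>m. 0 \<le> m \<Longrightarrow> m < 1 \<Longrightarrow> (G has_real_derivative 1 / (1 - m powr (2 / CARD('n)))) (at m)"
    and prof: "\<And>m. 0 \<le> m \<Longrightarrow> m < 1 \<Longrightarrow> profile CARD('n) (G m) = m"
    using profile_inverse[OF n] by metis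
  let ?a = "- real CARD('n) / 2"
  have "pot ?a x = (LINT z:cball b r|lebesgue. sqdist x z powr ?a)"
    unfolding pot_def unfolding K_def set_lebesgue_integral_def
    by (rule Bochner_Integration.integral_cong) (auto simp: indicator_def)
  also have "\<dots> = r ^ DIM(real^'n) * (LINT y:cball 0 1|lebesgue. sqdist x (b + r *\<^sub>R y) powr ?a)"
    by (rule set_integral_cball_affine[OF r continuous_on_sqdist_powr[OF x]])
  also have "(\<lambda>y. sqdist x (b + r *\<^sub>R y) powr ?a) = (\<lambda>y. shifted_sq (b - x) r y powr ?a)"
    by (simp add: sqdist_def shifted_sq_def algebra_simps)
  also have "r ^ DIM(real^'n) * (LINT y:cball 0 1|lebesgue. shifted_sq (b - x) r y powr ?a) =
      w * G ((r / R) ^ DIM(real^'n))"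
    unfolding w_def R_def by (rule integral_W[OF G]) (use r rR in \<open>auto simp: R_def\<close>)
  finally have p: "pot ?a x = w * G ((r / R) ^ CARD('n))" by simp
  have "potential (indicator K) x = pot ?a x / w"
    unfolding w_def by (rule potential_eq_pot[OF weighted_compact_axioms xK]) auto
  then have "potential (indicator K) x = G ((r / R) ^ CARD('n))" using p w0 by simp
  moreover have "0 \<le> (r / R) ^ CARD('n)" "(r / R) ^ CARD('n) < 1"
    using r rR n power_strict_mono[of "r / R" 1 "CARD('n)"] by auto
  ultimately show ?thesis using prof by (simp add: K_def R_def norm_minus_commute)
qed

text \<open>The second formula, with exponent -n/2, gives the Hessian of the fundamental solution of
  the Laplacian, whose gradient is a multiple of |x - b|^(-n) (x - b).\<close>

lemma sqdist_powr_vec_derivatives: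
  fixes b :: "real^'n"
  assumes "x \<noteq> b"
  shows "((\<lambda>x. sqdist b x powr a) has_derivative (\<lambda>v. ((2 * a * sqdist b x powr (a - 1)) *\<^sub>R (x - b)) \<bullet> v)) (at x)"
    and "((\<lambda>x. sqdist b x powr a *\<^sub>R (x - b)) has_derivative (\<lambda>v. (\<chi> i j. sqdist b x powr a * (if i = j then 1 else 0)
        + 2 * a * sqdist b x powr (a - 1) * ((x - b) $ i * (x - b) $ j)) *v v)) (at x)"
proof -
  have pos: "0 < sqdist b x" using assms by (intro sqdist_pos) simp
  have d: "(sqdist b has_derivative (\<lambda>v. 2 * ((x - b) \<bullet> v))) (at x)"
    unfolding sqdist_def by (auto intro!: derivative_eq_intros simp: inner_commute fun_eq_iff)
  show 1: "((\<lambda>x. sqdist b x powr a) has_derivative (\<lambda>v. ((2 * a * sqdist b x powr (a - 1)) *\<^sub>R (x - b)) \<bullet> v)) (at x)"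
    using has_derivative_powr[OF d has_derivative_const[of a] pos] pos
    by (auto simp: powr_diff fun_eq_iff elim!: has_derivative_eq_rhs)
  have "((\<lambda>x. sqdist b x powr a *\<^sub>R (x - b)) has_derivative
      (\<lambda>v. sqdist b x powr a *\<^sub>R (v - 0) + (((2 * a * sqdist b x powr (a - 1)) *\<^sub>R (x - b)) \<bullet> v) *\<^sub>R (x - b))) (at x)"
    by (intro has_derivative_scaleR[OF 1] has_derivative_diff has_derivative_ident has_derivative_const)
  then show "((\<lambda>x. sqdist b x powr a *\<^sub>R (x - b)) has_derivative (\<lambda>v. (\<chi> i j. sqdist b x powr a * (if i = j then 1 else 0)
        + 2 * a * sqdist b x powr (a - 1) * ((x - b) $ i * (x - b) $ j)) *v v)) (at x)"
  proof (rule has_derivative_eq_rhs)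
    show "(\<lambda>v. sqdist b x powr a *\<^sub>R (v - 0) + (((2 * a * sqdist b x powr (a - 1)) *\<^sub>R (x - b)) \<bullet> v) *\<^sub>R (x - b)) =
      (\<lambda>v. (\<chi> i j. sqdist b x powr a * (if i = j then 1 else 0)
        + 2 * a * sqdist b x powr (a - 1) * ((x - b) $ i * (x - b) $ j)) *v v)"
    proof (intro ext, unfold vec_eq_iff, intro allI)
      fix v :: "real^'n" and i
      define q p where "q = sqdist b x powr a" and "p = 2 * a * sqdist b x powr (a - 1)"
      have "((\<chi> i j. q * (if i = j then 1 else 0) + p * ((x - b) $ i * (x - b) $ j)) *v v) $ i =
          (\<Sum>j\<in>UNIV. q * (if i = j then v $ j else 0) + (p * (x - b) $ i) * ((x - b) $ j * v $ j))"
        unfolding matrix_vector_mult_def by (auto intro!: sum.cong simp: algebra_simps)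
      also have "\<dots> = q * v $ i + (p * (x - b) $ i) * ((x - b) \<bullet> v)"
        unfolding sum.distrib sum_distrib_left[symmetric] inner_vec_def by simp
      finally show "(sqdist b x powr a *\<^sub>R (v - 0) + (((2 * a * sqdist b x powr (a - 1)) *\<^sub>R (x - b)) \<bullet> v) *\<^sub>R (x - b)) $ i =
          ((\<chi> i j. sqdist b x powr a * (if i = j then 1 else 0)
        + 2 * a * sqdist b x powr (a - 1) * ((x - b) $ i * (x - b) $ j)) *v v) $ i"
        unfolding q_def[symmetric] p_def[symmetric] by (simp add: algebra_simps)
    qed
  qed
qed

text \<open>Off the ball the profile is (r/|x - b|)^n, so the transform is a fundamental solution
  centred at b: 2 ln (r/|x - b|) in the plane and (r/|x - b|)^(n-2) otherwise. The singularity b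
  lies inside the ball.\<close>

lemma profile_transform_cball_harmonic:
  fixes b :: "real^'n"
  assumes n: "CARD('n) \<ge> 2" and r: "0 < r"
  shows "harmonic_on (- cball b r) (profile_transform (indicator (cball b r)))"
proof -
  define S where "S = - cball b r"
  have S: "open S" by (simp add: S_def open_Compl)
  have Sb: "x \<noteq> b" if "x \<in> S" for x using that r by (auto simp: S_def)
  define n where "n = real CARD('n)"
  have n2: "n \<ge> 2" using n by (simp add: n_def)
  let ?u = "profile_transform (indicator (cball b r))"
  \<comment> \<open>The factor that gives both cases the gradient \<kappa> |x - b|^(-n) (x - b); in
    the plane the -2 is that of -ln |x - b|^2.\<close>
  define \<kappa> where "\<kappa> = (if CARD('n) = 2 then - 2 else - (n - 2) * r powr (n - 2))"
  define g where "g x = \<kappa> *\<^sub>R (sqdist b x powr (- n / 2) *\<^sub>R (x - b))" for x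
  define H :: "real^'n \<Rightarrow> real^'n^'n" where
    "H x = \<kappa> *\<^sub>R (\<chi> i j. sqdist b x powr (- n / 2) * (if i = j then 1 else 0)
        + 2 * (- n / 2) * sqdist b x powr (- n / 2 - 1) * ((x - b) $ i * (x - b) $ j))" for x
  define f where "f x = (if CARD('n) = 2 then 2 * ln r - ln (sqdist b x)
      else r powr (n - 2) * sqdist b x powr (- (n - 2) / 2))" for x
  have uf: "f x = ?u x" if x: "x \<in> S" for x
  proof -
    define R where "R = norm (x - b)"
    have R: "0 < R" using Sb[OF x] by (simp add: R_def)
    have q: "sqdist b x = R\<^sup>2" by (simp add: sqdist_def R_def power2_norm_eq_inner)
    have p: "profile CARD('n) (potential (indicator (cball b r)) x) = (r / R) ^ CARD('n)"
      unfolding R_def by (rule profile_potential_cball[OF n r]) (use x in \<open>simp add: S_def\<close>)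
    show ?thesis
    proof (cases "CARD('n) = 2")
      case True
      have "ln ((r / R)\<^sup>2) = 2 * ln r - ln (R\<^sup>2)"
        using r R by (simp add: ln_realpow ln_div)
      then show ?thesis using True p by (simp add: f_def profile_transform_def q)
    next
      case False
      have "((r / R) ^ CARD('n)) powr ((n - 2) / n) = ((r / R) powr n) powr ((n - 2) / n)"
        using r R by (simp add: n_def powr_realpow)
      also have "\<dots> = (r / R) powr (n - 2)" using n2 by (simp add: powr_powr)
      also have "\<dots> = r powr (n - 2) * (R powr 2) powr (- (n - 2) / 2)"
      proof -
        have "2 * (- (n - 2) / 2) = - (n - 2)" by simp
        then have "(R powr 2) powr (- (n - 2) / 2) = 1 / R powr (n - 2)"
          by (simp only: powr_powr powr_minus_divide)
        then show ?thesis using r R by (simp only: powr_divide) simp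
      qed
      also have "R powr 2 = sqdist b x" using R by (simp add: q)
      finally show ?thesis using False p by (simp add: f_def profile_transform_def n_def)
    qed
  qed
  have df: "(f has_derivative (\<lambda>v. g x \<bullet> v)) (at x)" if "x \<noteq> b" for x
  proof (cases "CARD('n) = 2")
    case True
    have pos: "0 < sqdist b x" using that by (intro sqdist_pos) simp
    have d: "(sqdist b has_derivative (\<lambda>v. 2 * ((x - b) \<bullet> v))) (at x)"
      unfolding sqdist_def by (auto intro!: derivative_eq_intros simp: inner_commute fun_eq_iff)
    have "((\<lambda>x. 2 * ln r - ln (sqdist b x)) has_derivative (\<lambda>v. 0 - (2 * ((x - b) \<bullet> v)) * inverse (sqdist b x))) (at x)"
      by (intro has_derivative_diff has_derivative_const has_derivative_ln[OF pos d, THEN has_derivative_eq_rhs])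
        (auto simp: fun_eq_iff field_simps)
    moreover have "sqdist b x powr - 1 = inverse (sqdist b x)" using pos by (simp add: powr_minus)
    ultimately show ?thesis using True
      by (auto simp: f_def[abs_def] g_def \<kappa>_def n_def fun_eq_iff elim!: has_derivative_eq_rhs)
  next
    case False
    have "((\<lambda>x. r powr (n - 2) * sqdist b x powr (- (n - 2) / 2)) has_derivative
       (\<lambda>v. r powr (n - 2) * (((2 * (- (n - 2) / 2) * sqdist b x powr (- (n - 2) / 2 - 1)) *\<^sub>R (x - b)) \<bullet> v))) (at x)"
      by (rule has_derivative_mult_right[OF sqdist_powr_vec_derivatives(1)[OF that]])
    moreover have "- (n - 2) / 2 - 1 = - n / 2" by (simp add: field_simps)
    ultimately show ?thesis using False
      by (auto simp: f_def[abs_def] g_def \<kappa>_def fun_eq_iff elim!: has_derivative_eq_rhs)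
  qed
  have du: "\<forall>x\<in>S. (?u has_derivative (\<lambda>v. g x \<bullet> v)) (at x)"
  proof
    fix x assume x: "x \<in> S"
    show "(?u has_derivative (\<lambda>v. g x \<bullet> v)) (at x)"
      by (rule has_derivative_transform_within_open[OF df[OF Sb[OF x]] S x]) (rule uf)
  qed
  have dg: "\<forall>x\<in>S. (g has_derivative (\<lambda>v. H x *v v)) (at x)"
  proof
    fix x assume x: "x \<in> S"
    show "(g has_derivative (\<lambda>v. H x *v v)) (at x)"
      unfolding g_def H_def scaleR_matrix_vector_assoc[symmetric]
      by (rule has_derivative_scaleR_right[OF sqdist_powr_vec_derivatives(2)[OF Sb[OF x]]])
  qed
  have Hc: "continuous_on S H"
  proof -
    have c: "continuous_on S (\<lambda>x. sqdist b x powr a)" for a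
      by (rule continuous_on_sqdist_powr) (use Sb in blast)
    show ?thesis
      unfolding H_def
      by (intro continuous_on_scaleR continuous_on_const continuous_on_vec_lambda continuous_on_add continuous_on_mult c
          continuous_on_component continuous_on_diff continuous_on_id)
  qed
  have "laplacian ?u x = 0" if x: "x \<in> S" for x
  proof -
    have pos: "0 < sqdist b x" using Sb[OF x] by (intro sqdist_pos) simp
    have "laplacian ?u x = (\<Sum>i\<in>UNIV. H x $ i $ i)"
      by (rule laplacian_eq_trace[OF S x du dg])
    also have "\<dots> = (\<Sum>i\<in>UNIV. \<kappa> * sqdist b x powr (- n / 2)
        - (\<kappa> * n * sqdist b x powr (- n / 2 - 1)) * ((x - b) $ i * (x - b) $ i))"
      unfolding H_def by (intro sum.cong) (auto simp: algebra_simps)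
    also have "\<dots> = n * (\<kappa> * sqdist b x powr (- n / 2)) - (\<kappa> * n * sqdist b x powr (- n / 2 - 1)) * sqdist b x"
      unfolding sum_subtractf sum_distrib_left[symmetric] sqdist_def inner_vec_def by (simp add: n_def)
    \<comment> \<open>The identity part of the Hessian has trace n |x - b|^(-n); the rank-one part
      contributes the same amount with opposite sign.\<close>
    also have "\<dots> = 0" using pos by (simp add: powr_diff)
    finally show ?thesis .
  qed
  then show ?thesis
    unfolding harmonic_on_def C2_on_def S_def[symmetric] using S du dg Hc by blast
qed

theorem theorem1p2:
  assumes "CARD('n::finite) \<ge> 2"
  shows "(\<forall>\<rho> :: real^'n \<Rightarrow> real.
            density_function \<rho> \<longrightarrow>
            (CARD('n) = 2 \<longrightarrow> emeasure lebesgue {x. \<rho> x \<noteq> 0} > 0) \<longrightarrow>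
            subharmonic_on (- essential_support \<rho>) (profile_transform \<rho>)) \<and>
         (\<forall>(c :: real^'n) r. r > 0 \<longrightarrow>
            harmonic_on (- cball c r) (profile_transform (indicator (cball c r))))"
  using profile_transform_subharmonic[OF assms] profile_transform_cball_harmonic[OF assms] by blast

end
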